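(* The variety of complex $3$-dimensional binary $\mathfrak{perm}$ superalgebras of type $(2,1)$ has dimension $4$ and has exactly $7$ irreducible components: $\overline{\mathcal{O}(\mathbf{R}_{01})},\ \overline{\mathcal{O}(\mathbf{R}_{02})},\ \overline{\mathcal{O}(\mathbf{R}_{04})},\ \overline{\mathcal{O}(\mathbf{R}_{10})},\ \overline{\mathcal{O}(\mathbf{R}_{25})},\ \overline{\mathcal{O}(\mathbf{R}_{31})},\ \overline{\mathcal{O}(\mathbf{R}_{33})}$. In particular, exactly $7$ superalgebras are rigid in this variety.
   Context: All algebras are over $\mathbb{C}$. A superalgebra is a $\mathbb{Z}_2$-graded algebra $A=A_0\oplus A_1$ with $A_iA_j\subseteq A_{i+j \bmod 2}$; $|x|\in\{0,1\}$ is the degree of a homogeneous $x$. It has type $(n,m)$ if $\dim A_0=n$, $\dim A_1=m$. The associator is $(x,y,z)=(xy)z-x(yz)$. A binary $\mathfrak{perm}$ superalgebra is a superalgebra satisfying, for all homogeneous $x,y,z$: $(x,y,z)=-(-1)^{|y||z|}(x,z,y)=-(-1)^{|x||y|}(y,x,z)$ and $(xy)z+(-1)^{|x||y|+|x||z|+|y||z|}(zy)x=(-1)^{|y||z|}(xz)y+(-1)^{|x||z|+|y||z|}(zx)y$. Geometric setting: fix a graded space $V=V_0\oplus V_1$ of type $(n,m)$ with a homogeneous basis. Superalgebra structures on $V$ are even bilinear maps $\mu:V\times V\to V$, identified with their structure constants; those satisfying a given family of graded polynomial identities form a Zariski-closed subset (an affine variety) of this affine space. The group $GL(V_0)\times GL(V_1)$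 acts by $(g*\mu)(x,y)=g\mu(g^{-1}x,g^{-1}y)$; its orbits are the isomorphism classes. $\mathcal{O}(A)$ denotes the orbit of (a structure representing) $A$ and $\overline{\mathcal{O}(A)}$ its Zariski closure. A superalgebra is rigid if its orbit is open in the variety. The dimension of the variety is the maximal dimension of its irreducible components. Superalgebras of type $(2,1)$, in basis $e_1,e_2$ (even), $f_1$ (odd), listed by nonzero products (unlisted products are zero): $\mathbf{R}_{01}$: $e_1e_1=e_1,\ e_2e_2=e_2$; $\mathbf{R}_{02}$: $e_1e_1=e_1,\ e_2e_2=e_2,\ e_1f_1=f_1,\ f_1e_1=f_1$; $\mathbf{R}_{04}$: $e_1e_1=e_1,\ e_2e_2=e_2,\ f_1e_1=f_1$; $\mathbf{R}_{10}$: $e_1e_1=e_1,\ f_1f_1=e_2$; $\mathbf{R}_{25}$: $e_1e_1=e_1,\ e_2e_1=e_2$; $\mathbf{R}_{31}$: $e_1e_1=e_1,\ e_2e_1=e_2,\ f_1e_1=f_1$; $\mathbf{R}_{33}$: $e_1e_1=e_1,\ e_2e_1=e_2,\ e_1f_1=f_1,\ f_1e_1=f_1$. *)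

theory Defs
  imports Complex_Main "HOL-Library.Function_Algebras"
begin

text \<open>Homogeneous basis: E1, E2 even, F1 odd.\<close>
datatype idx = E1 | E2 | F1

lemma UNIV_idx: "(UNIV :: idx set) = {E1, E2, F1}"
  by (auto intro: idx.exhaust)

instance idx :: finite
  by standard (simp add: UNIV_idx)

text \<open>Parity of a basis vector (True = odd).\<close>
fun par :: "idx \<Rightarrow> bool" where
  "par E1 = False" | "par E2 = False" | "par F1 = True"

type_synonym vec = "idx \<Rightarrow> complex"

text \<open>Structure constants: e_i e_j = sum_k (c i j k) e_k.\<close>
type_synonym sc = "idx \<Rightarrow> idx \<Rightarrow> idx \<Rightarrow> complex"

definition mult :: "sc \<Rightarrow> vec \<Rightarrow> vec \<Rightarrow> vec" where
  "mult c x y = (\<lambda>k. \<Sum>i\<in>UNIV. \<Sum>j\<in>UNIV. x i * y j * c i j k)"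

definition even_sc :: "sc \<Rightarrow> bool" where
  "even_sc c \<longleftrightarrow> (\<forall>i j k. par k \<noteq> (par i \<noteq> par j) \<longrightarrow> c i j k = 0)"

definition homog :: "vec \<Rightarrow> bool \<Rightarrow> bool" where
  "homog x d \<longleftrightarrow> (\<forall>i. par i \<noteq> d \<longrightarrow> x i = 0)"

definition sgn1 :: "bool \<Rightarrow> complex" where
  "sgn1 b = (if b then -1 else 1)"

definition smul :: "complex \<Rightarrow> vec \<Rightarrow> vec" where
  "smul s v = (\<lambda>k. s * v k)"

definition assoc :: "sc \<Rightarrow> vec \<Rightarrow> vec \<Rightarrow> vec \<Rightarrow> vec" where
  "assoc c x y z = mult c (mult c x y) z - mult c x (mult c y z)"

definition is_perm :: "sc \<Rightarrow> bool" where
  "is_perm c \<longleftrightarrow> (\<forall>x y z dx dy dz. homog x dx \<and> homog y dy \<and> homog z dz \<longrightarrow>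
     assoc c x y z = - smul (sgn1 (dy \<and> dz)) (assoc c x z y) \<and>
     assoc c x y z = - smul (sgn1 (dx \<and> dy)) (assoc c y x z) \<and>
     mult c (mult c x y) z
       + smul (sgn1 ((dx \<and> dy) \<noteq> ((dx \<and> dz) \<noteq> (dy \<and> dz)))) (mult c (mult c z y) x)
     = smul (sgn1 (dy \<and> dz)) (mult c (mult c x z) y)
       + smul (sgn1 ((dx \<and> dz) \<noteq> (dy \<and> dz))) (mult c (mult c z x) y))"

definition PermVar :: "sc set" where
  "PermVar = {c. even_sc c \<and> is_perm c}"

inductive_set zpoly :: "(sc \<Rightarrow> complex) set" where
  const: "(\<lambda>_. a) \<in> zpoly"
| coord: "(\<lambda>c. c i j k) \<in> zpoly"
| add: "p \<in> zpoly \<Longrightarrow> q \<in> zpoly \<Longrightarrow> (\<lambda>c. p c + q c) \<in> zpoly"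
| mul: "p \<in> zpoly \<Longrightarrow> q \<in> zpoly \<Longrightarrow> (\<lambda>c. p c * q c) \<in> zpoly"

definition zclosed :: "sc set \<Rightarrow> bool" where
  "zclosed A \<longleftrightarrow> (\<exists>S \<subseteq> zpoly. A = {c. \<forall>p\<in>S. p c = 0})"

definition zclosure :: "sc set \<Rightarrow> sc set" where
  "zclosure A = \<Inter>{C. zclosed C \<and> A \<subseteq> C}"

definition zirreducible :: "sc set \<Rightarrow> bool" where
  "zirreducible Y \<longleftrightarrow> Y \<noteq> {} \<and>
     (\<forall>C1 C2. zclosed C1 \<and> zclosed C2 \<and> Y \<subseteq> C1 \<union> C2 \<longrightarrow> Y \<subseteq> C1 \<or> Y \<subseteq> C2)"

definition irr_comp :: "sc set \<Rightarrow> sc set \<Rightarrow> bool" where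
  "irr_comp X Y \<longleftrightarrow> Y \<subseteq> X \<and> zclosed Y \<and> zirreducible Y \<and>
     (\<forall>Z. Z \<subseteq> X \<and> zirreducible Z \<and> Y \<subseteq> Z \<longrightarrow> Z = Y)"

definition irr_chain :: "sc set \<Rightarrow> nat \<Rightarrow> bool" where
  "irr_chain Y n \<longleftrightarrow> (\<exists>f :: nat \<Rightarrow> sc set.
     (\<forall>i\<le>n. zclosed (f i) \<and> zirreducible (f i) \<and> f i \<subseteq> Y) \<and>
     (\<forall>i<n. f i \<subset> f (Suc i)))"

definition zdim :: "sc set \<Rightarrow> nat \<Rightarrow> bool" where
  "zdim Y d \<longleftrightarrow> irr_chain Y d \<and> \<not> irr_chain Y (Suc d)"

definition var_dim :: "sc set \<Rightarrow> nat \<Rightarrow> bool" where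
  "var_dim X d \<longleftrightarrow> (\<forall>Y. irr_comp X Y \<longrightarrow> (\<exists>e. zdim Y e)) \<and>
     (\<exists>Y. irr_comp X Y \<and> zdim Y d) \<and>
     (\<forall>Y e. irr_comp X Y \<and> zdim Y e \<longrightarrow> e \<le> d)"

definition mat_mul :: "(idx \<Rightarrow> idx \<Rightarrow> complex) \<Rightarrow> (idx \<Rightarrow> idx \<Rightarrow> complex) \<Rightarrow> (idx \<Rightarrow> idx \<Rightarrow> complex)" where
  "mat_mul A B = (\<lambda>i j. \<Sum>l\<in>UNIV. A i l * B l j)"

definition mat_one :: "idx \<Rightarrow> idx \<Rightarrow> complex" where
  "mat_one = (\<lambda>i j. if i = j then 1 else 0)"

text \<open>g acts on vectors by (g x) k = sum_l g k l * x l; even = block diagonal.\<close>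
definition even_mat :: "(idx \<Rightarrow> idx \<Rightarrow> complex) \<Rightarrow> bool" where
  "even_mat g \<longleftrightarrow> (\<forall>k l. par k \<noteq> par l \<longrightarrow> g k l = 0)"

text \<open>(g * mu)(x,y) = g mu(g^{-1} x, g^{-1} y), with h = g^{-1}; structure constants.\<close>
definition act :: "(idx \<Rightarrow> idx \<Rightarrow> complex) \<Rightarrow> (idx \<Rightarrow> idx \<Rightarrow> complex) \<Rightarrow> sc \<Rightarrow> sc" where
  "act g h c = (\<lambda>i j k. \<Sum>l\<in>UNIV. g k l * (\<Sum>a\<in>UNIV. \<Sum>b\<in>UNIV. h a i * h b j * c a b l))"

definition orbit :: "sc \<Rightarrow> sc set" where
  "orbit c = {act g h c | g h. even_mat g \<and> mat_mul g h = mat_one \<and> mat_mul h g = mat_one}"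

definition rigid :: "sc set \<Rightarrow> sc \<Rightarrow> bool" where
  "rigid X c \<longleftrightarrow> c \<in> X \<and> (\<exists>C. zclosed C \<and> orbit c = X - C)"

definition sc_of :: "(idx \<times> idx \<times> idx) set \<Rightarrow> sc" where
  "sc_of P = (\<lambda>i j k. if (i, j, k) \<in> P then 1 else 0)"

definition "R01 = sc_of {(E1,E1,E1), (E2,E2,E2)}"
definition "R02 = sc_of {(E1,E1,E1), (E2,E2,E2), (E1,F1,F1), (F1,E1,F1)}"
definition "R04 = sc_of {(E1,E1,E1), (E2,E2,E2), (F1,E1,F1)}"
definition "R10 = sc_of {(E1,E1,E1), (F1,F1,E2)}"
definition "R25 = sc_of {(E1,E1,E1), (E2,E1,E2)}"
definition "R31 = sc_of {(E1,E1,E1), (E2,E1,E2), (F1,E1,F1)}"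
definition "R33 = sc_of {(E1,E1,E1), (E2,E1,E2), (E1,F1,F1), (F1,E1,F1)}"

end

theory Submission
  imports "HOL-Computational_Algebra.Polynomial" Defs
begin

text \<open>The identities force a structure to be of one of three kinds: a commutative associative even part with
  \<open>f1 f1 = 0\<close> and odd actions given by characters; an even product \<open>x y = \<chi>(x) \<chi>(y) u\<close> with trivial odd actions
  and \<open>f1 f1\<close> in the kernel of \<open>\<chi>\<close>; or an even product \<open>x y = \<phi>(y) x\<close>.  Commutative associative products on
  \<open>\<complex>\<^sup>2\<close> form a determinantal variety (three vectors spanning at most a line), and over \<open>\<complex>\<close> the coefficients
  further factor into linear forms.  This exhibits the variety as the union of seven images of affine spaces,
  each meeting one orbit generically; the orbits are separated by non-vanishing of
  polynomials in the trace form, the characters and the commutator, so they are open.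

  Dimension: each step of a chain of irreducible closed sets contributes a function vanishing on the smaller set, and
  these functions are algebraically independent on the top one.  Every component is dominated by a polynomial map
  from 4-space, where counting monomials excludes five algebraically independent functions.\<close>

subsection \<open>Zariski closed and irreducible sets\<close>

text \<open>No orbit closure is ever described by equations. An open orbit that meets the closure of
  another orbit in the variety coincides with that orbit, so the cover by seven irreducible closures
  has no inclusions, and components and rigid structures can be read off from it. The linear forms
  are there for the odd actions. A generic commutative even part has two nonzero characters, and
  naming one of them in terms of the determinantal coefficients requires a root of a quadratic.
  Splitting the quadratic form as a product of \<alpha> and \<beta> makes both characters polynomial
  in the parameters, and exchanging \<alpha> and \<beta> exchanges them, so one irreducible family
  suffices for each pair (\<epsilon>, \<eta>). The price is redundancy: \<alpha> and \<beta> can be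
  rescaled at the expense of s, which leaves six parameters for a four-dimensional image.
  Irreducibility is proved with all six; the dimension bound fixes both scalings.\<close>

lemma zpoly_sum: "(\<And>x. x \<in> A \<Longrightarrow> f x \<in> zpoly) \<Longrightarrow> (\<lambda>c. \<Sum>x\<in>A. f x c) \<in> zpoly"
proof (induction A rule: infinite_finite_induct)
  case (insert x A)
  then show ?case using zpoly.add[of "f x" "\<lambda>c. \<Sum>x\<in>A. f x c"] by simp
qed (auto intro: zpoly.const)

lemma zpoly_prod: "(\<And>x. x \<in> A \<Longrightarrow> f x \<in> zpoly) \<Longrightarrow> (\<lambda>c. \<Prod>x\<in>A. f x c) \<in> zpoly"
proof (induction A rule: infinite_finite_induct)
  case (insert x A)
  then show ?case using zpoly.mul[of "f x" "\<lambda>c. \<Prod>x\<in>A. f x c"] by simp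
qed (auto intro: zpoly.const)

lemma zpoly_power: "f \<in> zpoly \<Longrightarrow> (\<lambda>c. f c ^ n) \<in> zpoly"
  by (induction n) (auto intro: zpoly.const zpoly.mul)

lemma zpoly_uminus: "f \<in> zpoly \<Longrightarrow> (\<lambda>c. - f c) \<in> zpoly"
  using zpoly.mul[OF zpoly.const[of "-1"], of f] by simp

lemma zpoly_diff: "f \<in> zpoly \<Longrightarrow> g \<in> zpoly \<Longrightarrow> (\<lambda>c. f c - g c) \<in> zpoly"
  using zpoly.add[of f "\<lambda>c. - g c"] zpoly_uminus[of g] by simp

lemmas zpoly_intros = zpoly.intros zpoly_sum zpoly_prod zpoly_power zpoly_uminus zpoly_diff

lemma zclosedI: "S \<subseteq> zpoly \<Longrightarrow> zclosed {c. \<forall>p\<in>S. p c = 0}"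
  unfolding zclosed_def by blast

lemma zclosed_zero_set: "p \<in> zpoly \<Longrightarrow> zclosed {c. p c = 0}"
  using zclosedI[of "{p}"] by simp

lemma zclosedE:
  assumes "zclosed C" "c \<notin> C"
  obtains p where "p \<in> zpoly" "\<And>a. a \<in> C \<Longrightarrow> p a = 0" "p c \<noteq> 0"
  using assms unfolding zclosed_def by blast

lemma mem_zclosure_iff:
  "c \<in> zclosure A \<longleftrightarrow> (\<forall>p\<in>zpoly. (\<forall>a\<in>A. p a = 0) \<longrightarrow> p c = 0)" (is "?l \<longleftrightarrow> ?r")
proof
  assume ?l
  then show ?r
    unfolding zclosure_def using zclosed_zero_set by auto
next
  assume ?r
  then show ?l
    unfolding zclosure_def zclosed_def by blast
qed

lemma zclosed_zclosure: "zclosed (zclosure A)"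
proof -
  have "zclosure A = {c. \<forall>p\<in>{p\<in>zpoly. \<forall>a\<in>A. p a = 0}. p c = 0}"
    by (auto simp: mem_zclosure_iff)
  also have "zclosed \<dots>" by (rule zclosedI) auto
  finally show ?thesis .
qed

lemma subset_zclosure: "A \<subseteq> zclosure A"
  by (auto simp: mem_zclosure_iff)

lemma zclosure_minimal: "zclosed C \<Longrightarrow> A \<subseteq> C \<Longrightarrow> zclosure A \<subseteq> C"
  unfolding zclosure_def by blast

lemma zclosure_idem_subset: "A \<subseteq> zclosure B \<Longrightarrow> zclosure A \<subseteq> zclosure B"
  by (rule zclosure_minimal[OF zclosed_zclosure])

lemma zclosure_eqI: "A \<subseteq> zclosure B \<Longrightarrow> B \<subseteq> zclosure A \<Longrightarrow> zclosure A = zclosure B"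
  by (meson subset_antisym zclosure_idem_subset)

lemma zirreducible_zclosure:
  assumes "zirreducible Y" shows "zirreducible (zclosure Y)"
  unfolding zirreducible_def
proof (intro conjI allI impI)
  show "zclosure Y \<noteq> {}" using assms subset_zclosure unfolding zirreducible_def by blast
  fix C1 C2 assume C: "zclosed C1 \<and> zclosed C2 \<and> zclosure Y \<subseteq> C1 \<union> C2"
  then have "Y \<subseteq> C1 \<or> Y \<subseteq> C2"
    using assms subset_zclosure[of Y] unfolding zirreducible_def by (meson subset_trans)
  then show "zclosure Y \<subseteq> C1 \<or> zclosure Y \<subseteq> C2" using C zclosure_minimal by blast
qed

lemma zclosed_empty: "zclosed {}"
  using zclosed_zero_set[OF zpoly.const[of 1]] by simp

lemma zclosed_Un:
  assumes "zclosed A" "zclosed B" shows "zclosed (A \<union> B)"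
proof -
  obtain S T where S: "S \<subseteq> zpoly" "A = {c. \<forall>p\<in>S. p c = 0}"
    and T: "T \<subseteq> zpoly" "B = {c. \<forall>p\<in>T. p c = 0}"
    using assms unfolding zclosed_def by auto
  have "c \<in> A \<union> B \<longleftrightarrow> (\<forall>p\<in>S. \<forall>q\<in>T. p c * q c = 0)" for c
    unfolding S T by auto
  moreover have "(\<forall>r\<in>{\<lambda>c. p c * q c | p q. p \<in> S \<and> q \<in> T}. r c = 0) \<longleftrightarrow>
      (\<forall>p\<in>S. \<forall>q\<in>T. p c * q c = 0)" for c
    by fastforce
  ultimately have eq: "A \<union> B = {c. \<forall>r\<in>{\<lambda>c. p c * q c | p q. p \<in> S \<and> q \<in> T}. r c = 0}"
    by (intro set_eqI) simp
  show ?thesis unfolding eq using S T by (intro zclosedI) (auto intro!: zpoly.mul)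
qed

lemma zclosed_Union: "finite F \<Longrightarrow> (\<And>C. C \<in> F \<Longrightarrow> zclosed C) \<Longrightarrow> zclosed (\<Union>F)"
  by (induction F rule: finite_induct) (auto intro: zclosed_empty zclosed_Un)

lemma zirreducible_subset_Union:
  assumes "finite F" "zirreducible Z" "Z \<subseteq> \<Union>F" "\<And>C. C \<in> F \<Longrightarrow> zclosed C"
  shows "\<exists>C\<in>F. Z \<subseteq> C"
  using assms(1,3,4)
proof (induction F rule: finite_induct)
  case empty
  then show ?case using assms(2) by (auto simp: zirreducible_def)
next
  case (insert C F)
  have "zclosed (\<Union>F)" "zclosed C" "Z \<subseteq> C \<union> \<Union>F" using insert zclosed_Union by auto
  then have "Z \<subseteq> C \<or> Z \<subseteq> \<Union>F" using assms(2) unfolding zirreducible_def by blast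
  then show ?case using insert by auto
qed

subsection \<open>Polynomial maps from affine space\<close>

text \<open>Points are sequences indexed by all of nat, of which only the first \<open>n\<close>
  entries may occur; maps from 3-, 4- and 6-space thereby share one type.\<close>

inductive_set mpoly :: "nat \<Rightarrow> ((nat \<Rightarrow> complex) \<Rightarrow> complex) set" for n where
  const: "(\<lambda>_. a) \<in> mpoly n"
| var: "i < n \<Longrightarrow> (\<lambda>v. v i) \<in> mpoly n"
| add: "p \<in> mpoly n \<Longrightarrow> q \<in> mpoly n \<Longrightarrow> (\<lambda>v. p v + q v) \<in> mpoly n"
| mul: "p \<in> mpoly n \<Longrightarrow> q \<in> mpoly n \<Longrightarrow> (\<lambda>v. p v * q v) \<in> mpoly n"

lemma mpoly_uminus: "f \<in> mpoly n \<Longrightarrow> (\<lambda>c. - f c) \<in> mpoly n"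
  using mpoly.mul[OF mpoly.const[of "-1"], of f] by simp

lemma mpoly_diff: "f \<in> mpoly n \<Longrightarrow> g \<in> mpoly n \<Longrightarrow> (\<lambda>c. f c - g c) \<in> mpoly n"
  using mpoly.add[of f n "\<lambda>c. - g c"] mpoly_uminus[of g] by simp

lemma mpoly_power: "f \<in> mpoly n \<Longrightarrow> (\<lambda>c. f c ^ k) \<in> mpoly n"
  by (induction k) (auto intro: mpoly.const mpoly.mul)

lemmas mpoly_intros = mpoly.intros mpoly_uminus mpoly_diff mpoly_power

definition pmap :: "nat \<Rightarrow> ((nat \<Rightarrow> complex) \<Rightarrow> sc) \<Rightarrow> bool" where
  "pmap n \<Phi> \<longleftrightarrow> (\<forall>i j k. (\<lambda>v. \<Phi> v i j k) \<in> mpoly n)"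

lemma zpoly_pmap: "p \<in> zpoly \<Longrightarrow> pmap n \<Phi> \<Longrightarrow> (\<lambda>v. p (\<Phi> v)) \<in> mpoly n"
  by (induction p rule: zpoly.induct) (auto simp: pmap_def intro: mpoly.intros)

lemma mpoly_line:
  assumes "p \<in> mpoly n"
  shows "\<exists>P. \<forall>t. p (\<lambda>i. a i + t * b i) = poly P t"
  using assms
proof (induction p rule: mpoly.induct)
  case (const c)
  show ?case by (rule exI[of _ "[:c:]"]) simp
next
  case (var i)
  show ?case by (rule exI[of _ "[:a i, b i:]"]) simp
next
  case (add p q)
  then show ?case by (metis poly_add)
next
  case (mul p q)
  then show ?case by (metis poly_mult)
qed

text \<open>Restriction to the line through \<open>v\<close> (at t = 0) and \<open>w\<close> (at t =
  1) reduces this to univariate polynomials, which form an integral domain.\<close>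

lemma mpoly_integral:
  assumes "p \<in> mpoly n" "q \<in> mpoly n" "\<And>v. p v * q v = 0" "q w \<noteq> 0"
  shows "p v = 0"
proof -
  obtain P where P: "\<And>t. p (\<lambda>i. v i + t * (w i - v i)) = poly P t" 
    using mpoly_line[OF assms(1), of v "\<lambda>i. w i - v i"] by auto
  obtain Q where Q: "\<And>t. q (\<lambda>i. v i + t * (w i - v i)) = poly Q t" 
    using mpoly_line[OF assms(2), of v "\<lambda>i. w i - v i"] by auto
  have "poly (P * Q) t = 0" for t using assms(3) by (simp add: P[symmetric] Q[symmetric])
  then have "P * Q = 0" using poly_all_0_iff_0 by blast
  moreover have "Q \<noteq> 0" using Q[of 1] assms(4) by auto
  ultimately have "P = 0" by simp
  then show ?thesis using P[of 0] by simp
qed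

text \<open>The locus where a nonzero polynomial \<delta> does not vanish is dense in affine space,
  so membership in \<open>A\<close> has to be checked for generic parameters only.\<close>

lemma range_subset_zclosure:
  assumes "pmap n \<Phi>" "\<delta> \<in> mpoly n" "\<delta> w \<noteq> 0" "\<And>v. \<delta> v \<noteq> 0 \<Longrightarrow> \<Phi> v \<in> A"
  shows "range \<Phi> \<subseteq> zclosure A"
proof -
  have "p (\<Phi> v) = 0" if p: "p \<in> zpoly" "\<forall>a\<in>A. p a = 0" for p v
    using mpoly_integral[OF zpoly_pmap[OF p(1) assms(1)] assms(2) _ assms(3)] p(2) assms(4)
    by (metis mult_eq_0_iff)
  then show ?thesis by (auto simp: mem_zclosure_iff)
qed

lemma zirreducible_range:
  assumes "pmap n \<Phi>" shows "zirreducible (range \<Phi>)"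
  unfolding zirreducible_def
proof (intro conjI allI impI)
  fix C1 C2 assume C: "zclosed C1 \<and> zclosed C2 \<and> range \<Phi> \<subseteq> C1 \<union> C2"
  show "range \<Phi> \<subseteq> C1 \<or> range \<Phi> \<subseteq> C2"
  proof (rule ccontr)
    assume "\<not> ?thesis"
    then obtain v w where vw: "\<Phi> v \<notin> C1" "\<Phi> w \<notin> C2" by blast
    obtain p where p: "p \<in> zpoly" "\<And>a. a \<in> C1 \<Longrightarrow> p a = 0" "p (\<Phi> v) \<noteq> 0"
      using C vw(1) by (auto elim: zclosedE)
    obtain q where q: "q \<in> zpoly" "\<And>a. a \<in> C2 \<Longrightarrow> q a = 0" "q (\<Phi> w) \<noteq> 0"
      using C vw(2) by (auto elim: zclosedE)
    have "p (\<Phi> u) * q (\<Phi> u) = 0" for u using C p(2)[of "\<Phi> u"] q(2)[of "\<Phi> u"] by (metis UnE mult_eq_0_iff rangeI subsetD)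
    then show False
      using mpoly_integral[OF zpoly_pmap[OF p(1) assms] zpoly_pmap[OF q(1) assms]] p(3) q(3) by blast
  qed
qed simp

subsection \<open>Algebraic independence and chains\<close>

definition mon :: "('b \<Rightarrow> complex) list \<Rightarrow> nat list \<Rightarrow> 'b \<Rightarrow> complex" where
  "mon fs es z = (\<Prod>i<length fs. (fs ! i) z ^ (es ! i))"

lemma mon_Cons: "mon (f # fs) (e # es) z = f z ^ e * mon fs es z"
  unfolding mon_def by (simp add: prod.lessThan_Suc_shift del: prod.lessThan_Suc)

lemma zpoly_mon: "set fs \<subseteq> zpoly \<Longrightarrow> mon fs es \<in> zpoly"
  unfolding mon_def by (intro zpoly_prod zpoly_power) (use nth_mem in blast)

text \<open>A polynomial relation is encoded by a finite set of exponent lists with coefficients. It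
  is tested on the points of \<open>Z\<close> only, hence modulo the functions vanishing on
  \<open>Z\<close>.\<close>

definition alg_indep :: "('b \<Rightarrow> complex) list \<Rightarrow> 'b set \<Rightarrow> bool" where
  "alg_indep fs Z \<longleftrightarrow> (\<forall>A c. finite A \<longrightarrow> (\<forall>es\<in>A. length es = length fs) \<longrightarrow>
     (\<forall>z\<in>Z. (\<Sum>es\<in>A. c es * mon fs es z) = 0) \<longrightarrow> (\<forall>es\<in>A. c es = 0))"

lemma alg_indep_mono: "alg_indep fs Z \<Longrightarrow> Z \<subseteq> Z' \<Longrightarrow> alg_indep fs Z'"
  unfolding alg_indep_def by blast

lemma alg_indep_Nil: "z \<in> Z \<Longrightarrow> alg_indep [] Z"
  unfolding alg_indep_def
proof (intro allI impI ballI)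
  fix A c es
  assume z: "z \<in> Z" and A: "finite A" "\<forall>es\<in>A. length es = length ([] :: ('a \<Rightarrow> complex) list)" "es \<in> A"
    and s: "\<forall>z\<in>Z. (\<Sum>es\<in>A. c es * mon [] es z) = 0"
  from A have "A = {[]}" "es = []" by auto
  then show "c es = 0" using bspec[OF s z] by (simp add: mon_def)
qed

text \<open>Divide a hypothetical relation by the largest power of \<open>f\<close>, which is legitimate on the
  irreducible set \<open>Z'\<close>, and restrict the quotient to \<open>Z\<close>, where only its constant term in \<open>f\<close> survives.\<close>

lemma alg_indep_Cons:
  assumes irr: "zirreducible Z'" and sub: "Z \<subseteq> Z'" and fs: "set fs \<subseteq> zpoly" "alg_indep fs Z"
    and f: "f \<in> zpoly" "\<And>z. z \<in> Z \<Longrightarrow> f z = 0" and z0: "z0 \<in> Z'" "f z0 \<noteq> 0"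
  shows "alg_indep (f # fs) Z'"
  unfolding alg_indep_def
proof (intro allI impI, rule ccontr)
  fix A c
  assume A: "finite A" "\<forall>es\<in>A. length es = length (f # fs)"
    and rel: "\<forall>z\<in>Z'. (\<Sum>es\<in>A. c es * mon (f # fs) es z) = 0" and ne: "\<not> (\<forall>es\<in>A. c es = 0)"
  define B where "B = {es\<in>A. c es \<noteq> 0}"
  have B: "finite B" "B \<noteq> {}" using A ne by (auto simp: B_def)
  define k where "k = Min (hd ` B)"
  have k: "k \<le> hd es" if "es \<in> B" for es using B that by (simp add: k_def)
  have "k \<in> hd ` B" unfolding k_def using B by (intro Min_in) auto
  then obtain es0 where es0: "es0 \<in> B" "hd es0 = k" by auto
  have Cons: "es = hd es # tl es" "length (tl es) = length fs" if "es \<in> B" for es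
    using A(2) that by (cases es; auto simp: B_def)+
  define g where "g z = (\<Sum>es\<in>B. c es * (f z ^ (hd es - k) * mon fs (tl es) z))" for z
  have "f z ^ k * g z = 0" if "z \<in> Z'" for z
  proof -
    have "f z ^ k * g z = (\<Sum>es\<in>B. c es * (f z ^ k * f z ^ (hd es - k) * mon fs (tl es) z))"
      unfolding g_def by (simp add: sum_distrib_left mult_ac)
    also have "\<dots> = (\<Sum>es\<in>B. c es * mon (f # fs) es z)"
    proof (intro sum.cong refl)
      fix es assume es: "es \<in> B"
      then have "mon (f # fs) es z = f z ^ hd es * mon fs (tl es) z"
        using Cons(1)[OF es] mon_Cons by metis
      then show "c es * (f z ^ k * f z ^ (hd es - k) * mon fs (tl es) z) = c es * mon (f # fs) es z"
        using k[OF es] by (simp add: power_add[symmetric])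
    qed
    also have "\<dots> = (\<Sum>es\<in>A. c es * mon (f # fs) es z)"
      by (rule sum.mono_neutral_left) (use A in \<open>auto simp: B_def\<close>)
    finally show ?thesis using rel that by simp
  qed
  then have "Z' \<subseteq> {z. f z = 0} \<union> {z. g z = 0}" by auto
  moreover have "g \<in> zpoly"
    unfolding g_def using f fs by (intro zpoly_intros zpoly_mon) auto
  ultimately have g0: "g z = 0" if "z \<in> Z'" for z
    using irr z0 zclosed_zero_set[OF f(1)] zclosed_zero_set[of g] that
    unfolding zirreducible_def by blast
  define B0 where "B0 = {es\<in>B. hd es = k}"
  have inj: "inj_on tl B0"
    by (rule inj_onI) (metis (mono_tags, lifting) B0_def Cons(1) mem_Collect_eq)
  have "(\<Sum>es\<in>tl ` B0. c (k # es) * mon fs es z) = 0" if z: "z \<in> Z" for z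
  proof -
    have "0 = g z" using g0 z sub by auto
    also have "\<dots> = (\<Sum>es\<in>B0. c es * mon fs (tl es) z)"
      unfolding g_def
    proof (rule sum.mono_neutral_cong_right)
      show "\<forall>es\<in>B - B0. c es * (f z ^ (hd es - k) * mon fs (tl es) z) = 0"
        using f(2)[OF z] k by (force simp: B0_def)
    qed (use B in \<open>auto simp: B0_def\<close>)
    also have "\<dots> = (\<Sum>es\<in>B0. c (k # tl es) * mon fs (tl es) z)"
      by (intro sum.cong refl) (metis (mono_tags, lifting) B0_def Cons(1) mem_Collect_eq)
    also have "\<dots> = (\<Sum>es\<in>tl ` B0. c (k # es) * mon fs es z)"
      by (simp add: sum.reindex[OF inj])
    finally show ?thesis by simp
  qed
  moreover have "finite (tl ` B0)" "\<forall>es\<in>tl ` B0. length es = length fs"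
    using B Cons(2) by (auto simp: B0_def)
  ultimately have "\<forall>es\<in>tl ` B0. c (k # es) = 0"
    using fs(2)[unfolded alg_indep_def, rule_format, of "tl ` B0" "\<lambda>es. c (k # es)"] by blast
  then have "c es0 = 0" using es0 Cons(1)[OF es0(1)] by (force simp: B0_def)
  then show False using es0 by (simp add: B_def)
qed

lemma irr_chain_alg_indep:
  assumes "irr_chain Y n"
  shows "\<exists>fs. length fs = n \<and> set fs \<subseteq> zpoly \<and> alg_indep fs Y"
proof -
  obtain f where f: "\<And>i. i \<le> n \<Longrightarrow> zclosed (f i) \<and> zirreducible (f i) \<and> f i \<subseteq> Y"
    and lt: "\<And>i. i < n \<Longrightarrow> f i \<subset> f (Suc i)"
    using assms unfolding irr_chain_def by auto
  have "\<exists>fs. length fs = m \<and> set fs \<subseteq> zpoly \<and> alg_indep fs (f m)" if "m \<le> n" for m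
    using that
  proof (induction m)
    case 0
    have "f 0 \<noteq> {}" using f[of 0] by (simp add: zirreducible_def)
    then show ?case using alg_indep_Nil by (metis ex_in_conv list.set(1) empty_subsetI list.size(3))
  next
    case (Suc m)
    then obtain fs where fs: "length fs = m" "set fs \<subseteq> zpoly" "alg_indep fs (f m)" by auto
    have m: "f m \<subset> f (Suc m)" using lt Suc.prems by simp
    then obtain z where z: "z \<in> f (Suc m)" "z \<notin> f m" by auto
    moreover have "zclosed (f m)" using f Suc.prems by simp
    ultimately obtain p where "p \<in> zpoly" "\<And>a. a \<in> f m \<Longrightarrow> p a = 0" "p z \<noteq> 0"
      using zclosedE by metis
    moreover have "zirreducible (f (Suc m))" using f Suc.prems by simp
    ultimately have "alg_indep (p # fs) (f (Suc m))"
      using alg_indep_Cons m fs z by (metis psubsetE)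
    then show ?case using fs \<open>p \<in> zpoly\<close> by (intro exI[of _ "p # fs"]) auto
  qed
  then show ?thesis using f[of n] alg_indep_mono by (metis order_refl)
qed

lemma irr_chain_le: "irr_chain Y n \<Longrightarrow> m \<le> n \<Longrightarrow> irr_chain Y m"
  unfolding irr_chain_def by (elim exE, rule_tac x = f in exI) auto

section \<open>Linear relations among functions, and counting monomials\<close>

interpretation fun_space: vector_space "\<lambda>(a :: complex) (f :: 'b \<Rightarrow> complex) x. a * f x"
  by unfold_locales (auto simp: fun_eq_iff algebra_simps)

lemma sum_fun_apply: "(\<Sum>a\<in>A. f a) x = (\<Sum>a\<in>A. f a x)" for f :: "'a \<Rightarrow> 'b \<Rightarrow> complex"
  by (induction A rule: infinite_finite_induct) auto

text \<open>The family is indexed by \<open>A\<close> instead of being a set of functions, because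
  different exponent lists may yield the same function and must still count separately.\<close>

lemma linear_relation:
  fixes b :: "'a \<Rightarrow> 'b \<Rightarrow> complex"
  assumes "finite A" "finite B" "card B < card A" "\<And>a. a \<in> A \<Longrightarrow> b a \<in> fun_space.span B"
  obtains c where "\<exists>a\<in>A. c a \<noteq> 0" "\<And>x. (\<Sum>a\<in>A. c a * b a x) = 0"
proof (cases "inj_on b A")
  case True
  have "fun_space.dependent (b ` A)"
  proof (rule ccontr)
    assume "\<not> fun_space.dependent (b ` A)"
    then have "card (b ` A) \<le> card B"
      using fun_space.independent_span_bound[OF assms(2)] assms(4) by blast
    then show False using assms(3) card_image[OF True] by simp
  qed
  then obtain u where u: "\<exists>f\<in>b ` A. u f \<noteq> 0" "(\<Sum>f\<in>b ` A. (\<lambda>x. u f * f x)) = 0"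
    using fun_space.dependent_finite[of "b ` A"] assms(1) by auto
  show ?thesis
  proof (rule that[of "\<lambda>a. u (b a)"])
    show "\<exists>a\<in>A. u (b a) \<noteq> 0" using u(1) by auto
    fix x
    have "(\<Sum>f\<in>b ` A. u f * f x) = 0" using fun_cong[OF u(2), of x] by (simp add: sum_fun_apply)
    then show "(\<Sum>a\<in>A. u (b a) * b a x) = 0" by (simp add: sum.reindex[OF True])
  qed
next
  case False
  then obtain a a' where a: "a \<in> A" "a' \<in> A" "b a = b a'" "a \<noteq> a'" by (auto simp: inj_on_def)
  show ?thesis
  \<comment> \<open>Two indices with the same value give the relation "difference equals
    zero".\<close>
  proof (rule that[of "\<lambda>i. if i = a then 1 else if i = a' then -1 else 0"])
    show "\<exists>i\<in>A. (if i = a then 1 else if i = a' then -1 else 0) \<noteq> (0::complex)" using a by auto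
    fix x
    have "(\<Sum>i\<in>A. (if i = a then 1 else if i = a' then -1 else 0) * b i x)
      = (\<Sum>i\<in>{a, a'}. (if i = a then 1 else if i = a' then -1 else 0) * b i x)"
      by (rule sum.mono_neutral_right) (use assms(1) a in auto)
    then show "(\<Sum>i\<in>A. (if i = a then 1 else if i = a' then -1 else 0) * b i x) = 0"
      using a by simp
  qed
qed

text \<open>Bounding every exponent separately, not the total degree, makes the count a plain
  power.\<close>

definition monoms :: "nat \<Rightarrow> nat \<Rightarrow> ((nat \<Rightarrow> complex) \<Rightarrow> complex) set" where
  "monoms n d = mon (map (\<lambda>i v. v i) [0..<n]) ` {es. set es \<subseteq> {..d} \<and> length es = n}"

lemma finite_monoms: "finite (monoms n d)" and card_monoms: "card (monoms n d) \<le> Suc d ^ n"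
proof -
  have "finite {es. set es \<subseteq> {..d} \<and> length es = n}" by (intro finite_lists_length_eq) simp
  then show "finite (monoms n d)" "card (monoms n d) \<le> Suc d ^ n"
    unfolding monoms_def using card_image_le card_lists_length_eq[of "{..d}" n] by fastforce+
qed

lemma monoms_mono: "d \<le> d' \<Longrightarrow> monoms n d \<subseteq> monoms n d'"
  unfolding monoms_def by (intro image_mono) auto

lemma monoms_mult:
  assumes "p \<in> monoms n d" "q \<in> monoms n d'" shows "(\<lambda>v. p v * q v) \<in> monoms n (d + d')"
proof -
  obtain es where es: "p = mon (map (\<lambda>i v. v i) [0..<n]) es" "set es \<subseteq> {..d}" "length es = n"
    using assms(1) by (auto simp: monoms_def)
  obtain es' where es': "q = mon (map (\<lambda>i v. v i) [0..<n]) es'" "set es' \<subseteq> {..d'}" "length es' = n"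
    using assms(2) by (auto simp: monoms_def)
  have "(\<lambda>v. p v * q v) = mon (map (\<lambda>i v. v i) [0..<n]) (map2 (+) es es')"
    using es es' by (auto simp: mon_def fun_eq_iff prod.distrib[symmetric] power_add)
  moreover have "set (map2 (+) es es') \<subseteq> {..d + d'}"
  proof
    fix x assume "x \<in> set (map2 (+) es es')"
    then obtain a b where ab: "(a, b) \<in> set (zip es es')" "x = a + b" by auto
    then have "a \<le> d" "b \<le> d'"
      using es(2) es'(2) set_zip_leftD[OF ab(1)] set_zip_rightD[OF ab(1)] by auto
    then show "x \<in> {..d + d'}" using ab(2) by simp
  qed
  ultimately show ?thesis using es(3) es'(3) unfolding monoms_def by auto
qed

lemma span_monoms_mult:
  assumes "p \<in> fun_space.span (monoms n d)" "q \<in> fun_space.span (monoms n d')"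
  shows "(\<lambda>v. p v * q v) \<in> fun_space.span (monoms n (d + d'))"
proof -
  have 1: "(\<lambda>v. p v * q v) \<in> fun_space.span (monoms n (d + d'))" if "p \<in> monoms n d" for p
    using assms(2)
  proof (induction rule: fun_space.span_induct_alt)
    case base
    show ?case using fun_space.span_zero by (simp add: zero_fun_def)
  next
    case (step c x y)
    have "(\<lambda>v. p v * ((\<lambda>v. c * x v) + y) v) = (\<lambda>v. c * (p v * x v)) + (\<lambda>v. p v * y v)"
      by (auto simp: fun_eq_iff algebra_simps)
    then show ?case
      using fun_space.span_add[OF fun_space.span_scale[OF fun_space.span_base[OF monoms_mult[OF that step(1)]]] step(2)]
      by (simp only:)
  qed
  show ?thesis using assms(1)
  proof (induction rule: fun_space.span_induct_alt)
    case base
    show ?case using fun_space.span_zero by (simp add: zero_fun_def)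
  next
    case (step c x y)
    have "(\<lambda>v. ((\<lambda>v. c * x v) + y) v * q v) = (\<lambda>v. c * (x v * q v)) + (\<lambda>v. y v * q v)"
      by (auto simp: fun_eq_iff algebra_simps)
    then show ?case
      using fun_space.span_add[OF fun_space.span_scale[OF 1[OF step(1)]] step(2)] by (simp only:)
  qed
qed

lemma one_monoms: "(\<lambda>_. 1) \<in> monoms n d"
proof -
  have "(\<lambda>_. 1) = mon (map (\<lambda>i v. v i) [0..<n]) (replicate n 0)"
    by (auto simp: mon_def fun_eq_iff)
  then show ?thesis unfolding monoms_def by auto
qed

lemma span_monoms_const: "(\<lambda>_. a) \<in> fun_space.span (monoms n d)"
  using fun_space.span_scale[OF fun_space.span_base[OF one_monoms], of a] by simp

lemma mpoly_span:
  assumes "p \<in> mpoly n" shows "\<exists>d. p \<in> fun_space.span (monoms n d)"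
  using assms
proof (induction p rule: mpoly.induct)
  case (const a)
  show ?case using span_monoms_const by blast
next
  case (var i)
  have "(\<lambda>v. v i) = mon (map (\<lambda>i v. v i) [0..<n]) ((replicate n 0)[i := 1])"
  proof
    fix v :: "nat \<Rightarrow> complex"
    have "mon (map (\<lambda>i v. v i) [0..<n]) ((replicate n 0)[i := 1]) v = (\<Prod>j<n. if j = i then v i else 1)"
      unfolding mon_def using var by (intro prod.cong) (auto simp: nth_list_update)
    then show "v i = mon (map (\<lambda>i v. v i) [0..<n]) ((replicate n 0)[i := 1]) v"
      using var by simp
  qed
  moreover have "set ((replicate n 0)[i := 1::nat]) \<subseteq> {..1}"
    by (rule order_trans[OF set_update_subset_insert]) auto
  ultimately have "(\<lambda>v. v i) \<in> monoms n 1" unfolding monoms_def by auto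
  then show ?case using fun_space.span_base by blast
next
  case (add p q)
  then obtain d d' where "p \<in> fun_space.span (monoms n d)" "q \<in> fun_space.span (monoms n d')" by auto
  then have "p \<in> fun_space.span (monoms n (max d d'))" "q \<in> fun_space.span (monoms n (max d d'))"
    using fun_space.span_mono[OF monoms_mono] by (meson max.cobounded1 max.cobounded2 subsetD)+
  from fun_space.span_add[OF this] show ?case by (auto simp: plus_fun_def)
next
  case (mul p q)
  then show ?case using span_monoms_mult by blast
qed

lemma span_monoms_power:
  "p \<in> fun_space.span (monoms n d) \<Longrightarrow> (\<lambda>v. p v ^ k) \<in> fun_space.span (monoms n (k * d))"
proof (induction k)
  case 0
  show ?case using span_monoms_const by simp
next
  case (Suc k)
  then show ?case using span_monoms_mult[of p n d "\<lambda>v. p v ^ k" "k * d"] by simp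
qed

lemma span_monoms_mon:
  assumes "\<And>f. f \<in> set fs \<Longrightarrow> f \<in> fun_space.span (monoms n d)"
    "length es = length fs" "set es \<subseteq> {..N}"
  shows "mon fs es \<in> fun_space.span (monoms n (N * length fs * d))"
  using assms
proof (induction fs arbitrary: es)
  case Nil
  then show ?case using span_monoms_const[of 1] by (simp add: mon_def fun_eq_iff)
next
  case (Cons f fs)
  then obtain e es' where es: "es = e # es'" by (cases es) auto
  have "mon fs es' \<in> fun_space.span (monoms n (N * length fs * d))"
    using Cons es by simp
  moreover have "(\<lambda>v. f v ^ e) \<in> fun_space.span (monoms n (N * d))"
  proof -
    have "e * d \<le> N * d" using Cons.prems es by simp
    then show ?thesis
      using span_monoms_power[OF Cons.prems(1)[of f], of e] fun_space.span_mono[OF monoms_mono[of "e * d" "N * d" n]]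
      by auto
  qed
  ultimately have "(\<lambda>v. f v ^ e * mon fs es' v) \<in> fun_space.span (monoms n (N * d + N * length fs * d))"
    using span_monoms_mult by blast
  moreover have "(\<lambda>v. f v ^ e * mon fs es' v) = mon (f # fs) es"
    using es by (simp add: mon_Cons fun_eq_iff)
  ultimately show ?case by (simp add: algebra_simps)
qed

text \<open>There are \<open>(N + 1)^(n + 1)\<close> monomials of multidegree at most \<open>N\<close> in \<open>n + 1\<close> polynomials
  on \<open>n\<close>-space, but they lie in a space of dimension \<open>O(N^n)\<close>.\<close>

lemma not_alg_indep_zclosure_range:
  assumes \<Phi>: "pmap n \<Phi>" and Y: "Y \<subseteq> zclosure (range \<Phi>)"
    and fs: "length fs = Suc n" "set fs \<subseteq> zpoly"
  shows "\<not> alg_indep fs Y"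
proof
  assume ind: "alg_indep fs Y"
  define gs where "gs = map (\<lambda>f v. f (\<Phi> v)) fs"
  have "\<forall>g\<in>set gs. \<exists>d. g \<in> fun_space.span (monoms n d)"
    unfolding gs_def using fs(2) mpoly_span[OF zpoly_pmap[OF _ \<Phi>]] by auto
  then obtain dg where dg: "\<And>g. g \<in> set gs \<Longrightarrow> g \<in> fun_space.span (monoms n (dg g))" by metis
  define d where "d = (\<Sum>g\<in>set gs. dg g)"
  have gd: "g \<in> fun_space.span (monoms n d)" if "g \<in> set gs" for g
  proof -
    have "dg g \<le> d" unfolding d_def using that by (intro member_le_sum) auto
    then show ?thesis using dg[OF that] fun_space.span_mono[OF monoms_mono] by blast
  qed
  define D where "D = length gs * d"
  \<comment> \<open>With this choice ((N + 1) (D + 1))^n = (N + 1)^n N, which is just below the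
    number (N + 1)^(n + 1) of exponent lists.\<close>
  define N where "N = Suc D ^ n"
  define A where "A = {es. set es \<subseteq> {..N} \<and> length es = Suc n}"
  have A: "finite A" "card A = Suc N ^ Suc n"
    unfolding A_def by (simp_all add: finite_lists_length_eq card_lists_length_eq)
  have "card (monoms n (N * D)) \<le> Suc (N * D) ^ n" by (rule card_monoms)
  also have "\<dots> \<le> (Suc N * Suc D) ^ n" by (intro power_mono) auto
  also have "\<dots> < Suc N ^ Suc n"
    by (simp only: power_mult_distrib N_def[symmetric]) simp
  finally have "card (monoms n (N * D)) < card A" using A by simp
  moreover have "mon gs es \<in> fun_space.span (monoms n (N * D))" if "es \<in> A" for es
    using span_monoms_mon[OF gd, of gs es N] that fs(1) by (simp add: A_def D_def gs_def algebra_simps)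
  ultimately obtain c where c: "\<exists>es\<in>A. c es \<noteq> 0" "\<And>v. (\<Sum>es\<in>A. c es * mon gs es v) = 0"
    using linear_relation[OF A(1) finite_monoms, of n "N * D" "mon gs"] by blast
  \<comment> \<open>The relation among the pullbacks is a polynomial vanishing on the range of
    \<Phi>, hence on its closure and on \<open>Y\<close>.\<close>
  have "(\<Sum>es\<in>A. c es * mon fs es z) = 0" if "z \<in> Y" for z
  proof -
    have "(\<lambda>z. \<Sum>es\<in>A. c es * mon fs es z) \<in> zpoly"
      using fs(2) by (intro zpoly_intros zpoly_mon)
    moreover have "mon fs es (\<Phi> v) = mon gs es v" for es v
      by (simp add: mon_def gs_def)
    moreover have "z \<in> zclosure (range \<Phi>)" using Y that by blast
    ultimately show ?thesis
      unfolding mem_zclosure_iff by (elim ballE[where x = "\<lambda>z. \<Sum>es\<in>A. c es * mon fs es z"]) (auto simp: c(2))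
  qed
  moreover have "\<forall>es\<in>A. length es = length fs" using fs by (auto simp: A_def)
  ultimately show False
    using ind[unfolded alg_indep_def, rule_format, of A c] c(1) A(1) by blast
qed

lemma irr_chain_bound:
  "pmap n \<Phi> \<Longrightarrow> Y \<subseteq> zclosure (range \<Phi>) \<Longrightarrow> \<not> irr_chain Y (Suc n)"
  using irr_chain_alg_indep not_alg_indep_zclosure_range by blast

subsection \<open>The group action\<close>

lemma sum_idx: "(\<Sum>i\<in>UNIV. f i) = f E1 + f E2 + f F1" for f :: "idx \<Rightarrow> complex"
  by (simp add: UNIV_idx)

lemma all_idx: "(\<forall>i. P i) \<longleftrightarrow> P E1 \<and> P E2 \<and> P F1"
  by (metis idx.exhaust)

definition mv :: "(idx \<Rightarrow> idx \<Rightarrow> complex) \<Rightarrow> vec \<Rightarrow> vec" where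
  "mv g x = (\<lambda>k. \<Sum>l\<in>UNIV. g k l * x l)"

lemma mv_mv: "mv g (mv h x) = mv (mat_mul g h) x"
  by (simp add: mv_def mat_mul_def sum_idx fun_eq_iff algebra_simps)

lemma mv_one: "mv mat_one x = x"
  by (auto simp: mv_def mat_one_def fun_eq_iff all_idx sum_idx)

lemma mv_linear: "mv g (x + y) = mv g x + mv g y" "mv g (x - y) = mv g x - mv g y"
  "mv g (- x) = - mv g x" "mv g (smul s x) = smul s (mv g x)"
  by (simp_all add: mv_def smul_def sum_idx fun_eq_iff algebra_simps)

lemma homog_mv: "even_mat g \<Longrightarrow> homog x d \<Longrightarrow> homog (mv g x) d"
  by (cases d) (auto simp: even_mat_def homog_def mv_def all_idx sum_idx)

lemma mult_act: "mult (act g h c) x y = mv g (mult c (mv h x) (mv h y))"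
  by (rule ext) (simp add: mult_def mv_def act_def sum_idx algebra_simps)

text \<open>Structure constants are products of basis vectors. Laws of \<open>act\<close> can thus
  be checked on products, where they become compositions of linear maps.\<close>

lemma sc_eqI:
  assumes "\<And>x y. mult c x y = mult c' x y" shows "c = c'"
proof (intro ext)
  fix i j k
  show "c i j k = c' i j k"
    using fun_cong[OF assms[of "mat_one i" "mat_one j"], of k]
    by (cases i; cases j) (simp_all add: mult_def mat_one_def sum_idx)
qed

lemma act_act: "act g h (act g' h' c) = act (mat_mul g g') (mat_mul h' h) c"
  by (rule sc_eqI) (simp add: mult_act mv_mv)

lemma mat_mul_assoc: "mat_mul (mat_mul a b) c = mat_mul a (mat_mul b c)"
  by (simp add: mat_mul_def sum_idx fun_eq_iff algebra_simps)

lemma mat_mul_one: "mat_mul mat_one a = a" "mat_mul a mat_one = a"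
  by (auto simp: mat_mul_def mat_one_def sum_idx fun_eq_iff all_idx)

lemma even_mat_one: "even_mat mat_one"
  by (auto simp: even_mat_def mat_one_def)

lemma even_mat_mul: "even_mat a \<Longrightarrow> even_mat b \<Longrightarrow> even_mat (mat_mul a b)"
  by (simp add: even_mat_def mat_mul_def sum_idx all_idx)

text \<open>\<open>orbit\<close> demands evenness of \<open>g\<close> only, whereas symmetry of
  orbits and invariance of the variety need it for the inverse. The odd diagonal entry of a block
  diagonal invertible \<open>g\<close> is nonzero, and this kills the mixed entries of
  \<open>h\<close>.\<close>

lemma even_mat_inverse:
  assumes "even_mat g" "mat_mul g h = mat_one" "mat_mul h g = mat_one"
  shows "even_mat h"
proof -
  have 1: "g F1 F1 * h F1 F1 = 1" "g F1 F1 * h F1 E1 = 0" "g F1 F1 * h F1 E2 = 0"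
    using assms(1) fun_cong[OF fun_cong[OF assms(2), of F1]]
    by (auto simp: mat_mul_def mat_one_def even_mat_def sum_idx all_idx)
  have 2: "h E1 F1 * g F1 F1 = 0" "h E2 F1 * g F1 F1 = 0"
    using assms(1) fun_cong[OF fun_cong[OF assms(3)], of _ F1]
    by (auto simp: mat_mul_def mat_one_def even_mat_def sum_idx all_idx)
  have "g F1 F1 \<noteq> 0" using 1(1) by auto
  then show ?thesis using 1 2 by (simp add: even_mat_def all_idx)
qed

lemma act_one: "act mat_one mat_one c = c"
  by (rule sc_eqI) (simp add: mult_act mv_one)

lemma orbit_refl: "c \<in> orbit c"
  unfolding orbit_def using act_one[of c] even_mat_one by (auto simp: mat_mul_one intro!: exI[of _ mat_one])

lemma orbit_subset:
  assumes "c' \<in> orbit c" shows "orbit c' \<subseteq> orbit c"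
proof
  fix d assume "d \<in> orbit c'"
  then obtain g h where 1: "d = act g h c'" "even_mat g" "mat_mul g h = mat_one" "mat_mul h g = mat_one"
    unfolding orbit_def by auto
  obtain g' h' where 2: "c' = act g' h' c" "even_mat g'" "mat_mul g' h' = mat_one" "mat_mul h' g' = mat_one"
    using assms unfolding orbit_def by auto
  have "mat_mul (mat_mul g g') (mat_mul h' h) = mat_mul g (mat_mul (mat_mul g' h') h)"
    "mat_mul (mat_mul h' h) (mat_mul g g') = mat_mul h' (mat_mul (mat_mul h g) g')"
    by (simp_all add: mat_mul_assoc)
  then have "mat_mul (mat_mul g g') (mat_mul h' h) = mat_one" "mat_mul (mat_mul h' h) (mat_mul g g') = mat_one"
    using 1 2 by (simp_all add: mat_mul_one)
  moreover have "d = act (mat_mul g g') (mat_mul h' h) c" using 1 2 by (simp add: act_act)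
  ultimately show "d \<in> orbit c" using 1 2 even_mat_mul unfolding orbit_def by blast
qed

lemma orbit_sym:
  assumes "c' \<in> orbit c" shows "c \<in> orbit c'"
proof -
  obtain g h where 1: "c' = act g h c" "even_mat g" "mat_mul g h = mat_one" "mat_mul h g = mat_one"
    using assms unfolding orbit_def by auto
  have "c = act h g c'" using 1 by (simp add: act_act act_one)
  then show ?thesis using 1 even_mat_inverse[OF 1(2-4)] unfolding orbit_def by blast
qed

lemma orbit_eq: "c \<in> orbit a \<Longrightarrow> c \<in> orbit b \<Longrightarrow> orbit a = orbit b"
  by (meson orbit_subset orbit_sym subset_antisym subsetD)

section \<open>Invariance and closedness of the variety\<close>

lemma assoc_act:
  assumes "mat_mul h g = mat_one"
  shows "assoc (act g h c) x y z = mv g (assoc c (mv h x) (mv h y) (mv h z))"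
  using assms by (simp add: assoc_def mult_act mv_mv mv_one mv_linear)

lemma even_sc_act:
  assumes "even_mat g" "even_mat h" "even_sc c" shows "even_sc (act g h c)"
  using assms by (simp add: even_sc_def even_mat_def act_def sum_idx all_idx)

lemma is_perm_act:
  assumes "even_mat h" "mat_mul h g = mat_one" "is_perm c"
  shows "is_perm (act g h c)"
  unfolding is_perm_def
proof (intro allI impI)
  fix x y z dx dy dz
  assume "homog x dx \<and> homog y dy \<and> homog z dz"
  then have "homog (mv h x) dx \<and> homog (mv h y) dy \<and> homog (mv h z) dz"
    using homog_mv[OF assms(1)] by blast
  note perm = assms(3)[unfolded is_perm_def, rule_format, OF this]
  have m: "mult (act g h c) (mult (act g h c) a b) d = mv g (mult c (mult c (mv h a) (mv h b)) (mv h d))" for a b d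
    using assms(2) by (simp add: mult_act mv_mv mv_one)
  show "assoc (act g h c) x y z = - smul (sgn1 (dy \<and> dz)) (assoc (act g h c) x z y) \<and>
     assoc (act g h c) x y z = - smul (sgn1 (dx \<and> dy)) (assoc (act g h c) y x z) \<and>
     mult (act g h c) (mult (act g h c) x y) z
       + smul (sgn1 ((dx \<and> dy) \<noteq> ((dx \<and> dz) \<noteq> (dy \<and> dz)))) (mult (act g h c) (mult (act g h c) z y) x)
     = smul (sgn1 (dy \<and> dz)) (mult (act g h c) (mult (act g h c) x z) y)
       + smul (sgn1 ((dx \<and> dz) \<noteq> (dy \<and> dz))) (mult (act g h c) (mult (act g h c) z x) y)"
    unfolding m assoc_act[OF assms(2)] mv_linear[symmetric]
    by (intro conjI; rule arg_cong[where f = "mv g"]; use perm in blast)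
qed

lemma orbit_subset_PermVar: "c \<in> PermVar \<Longrightarrow> orbit c \<subseteq> PermVar"
  unfolding orbit_def PermVar_def using even_sc_act is_perm_act even_mat_inverse by blast

lemma zpoly_mult:
  assumes "\<And>k. (\<lambda>c. x c k) \<in> zpoly" "\<And>k. (\<lambda>c. y c k) \<in> zpoly"
  shows "(\<lambda>c. mult c (x c) (y c) k) \<in> zpoly"
  unfolding mult_def by (intro zpoly_intros assms)

lemma zpoly_assoc: "(\<lambda>c. assoc c x y z k) \<in> zpoly"
  unfolding assoc_def fun_diff_def by (intro zpoly_intros zpoly_mult)

text \<open>The closure of an intersection of closed sets lies in each of them. The index type may
  be infinite, which is what identities quantified over vectors require.\<close>

lemma zclosed_Collect_all:
  assumes "\<And>x. zclosed {c. P x c}" shows "zclosed {c. \<forall>x. P x c}"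
proof -
  have "zclosure {c. \<forall>x. P x c} \<subseteq> {c. P x c}" for x
    by (rule zclosure_minimal[OF assms]) blast
  then have "zclosure {c. \<forall>x. P x c} = {c. \<forall>x. P x c}"
    using subset_zclosure[of "{c. \<forall>x. P x c}"] by blast
  then show ?thesis using zclosed_zclosure by metis
qed

lemma zclosed_Collect_conj:
  "zclosed {c. P c} \<Longrightarrow> zclosed {c. Q c} \<Longrightarrow> zclosed {c. P c \<and> Q c}"
proof -
  assume "zclosed {c. P c}" "zclosed {c. Q c}"
  \<comment> \<open>A conjunction is treated as a family indexed by bool.\<close>
  then have "zclosed {c. (b \<longrightarrow> P c) \<and> (\<not> b \<longrightarrow> Q c)}" for b by (cases b) auto
  then show ?thesis
    using zclosed_Collect_all[of "\<lambda>b c. (b \<longrightarrow> P c) \<and> (\<not> b \<longrightarrow> Q c)"]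
    by (simp add: all_bool_eq conj_commute)
qed

lemma zclosed_Collect_imp:
  "(Q \<Longrightarrow> zclosed {c. P c}) \<Longrightarrow> zclosed {c. Q \<longrightarrow> P c}"
  using zclosed_zero_set[OF zpoly.const[of 0]] by (cases Q) auto

lemma zclosed_Collect_eq:
  "p \<in> zpoly \<Longrightarrow> q \<in> zpoly \<Longrightarrow> zclosed {c. p c = q c}"
  using zclosed_zero_set[OF zpoly_diff[of p q]] by simp

lemma zclosed_PermVar: "zclosed PermVar"
proof -
  have "zclosed {c. even_sc c}" unfolding even_sc_def
    by (intro zclosed_Collect_all zclosed_Collect_imp zclosed_Collect_eq zpoly.intros)
  moreover have "zclosed {c. is_perm c}"
    unfolding is_perm_def fun_eq_iff smul_def plus_fun_apply uminus_apply
    by (intro zclosed_Collect_all zclosed_Collect_imp zclosed_Collect_conj zclosed_Collect_eq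
        zpoly_assoc zpoly_uminus zpoly.add zpoly.mul zpoly.const zpoly_mult zpoly.coord)
  ultimately show ?thesis unfolding PermVar_def by (rule zclosed_Collect_conj)
qed

subsection \<open>Coordinates\<close>

text \<open>These are the 14 constants that evenness leaves free: \<open>a\<close>,
  \<open>b\<close>, \<open>c\<close>, \<open>d\<close> hold the components of e1 e1, e1 e2, e2 e1,
  e2 e2; \<open>p\<close> and \<open>q\<close> are the scalars by which the even basis vectors act
  on f1 from the left and from the right; \<open>s\<close> holds f1 f1.\<close>

definition mk :: "complex \<Rightarrow> complex \<Rightarrow> complex \<Rightarrow> complex \<Rightarrow> complex \<Rightarrow> complex \<Rightarrow> complex \<Rightarrow> complex \<Rightarrow>
    complex \<Rightarrow> complex \<Rightarrow> complex \<Rightarrow> complex \<Rightarrow> complex \<Rightarrow> complex \<Rightarrow> sc" where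
  "mk a1 a2 b1 b2 c1 c2 d1 d2 p1 p2 q1 q2 s1 s2 = (\<lambda>i j k. case i of
     E1 \<Rightarrow> (case j of E1 \<Rightarrow> (case k of E1 \<Rightarrow> a1 | E2 \<Rightarrow> a2 | F1 \<Rightarrow> 0)
                  | E2 \<Rightarrow> (case k of E1 \<Rightarrow> b1 | E2 \<Rightarrow> b2 | F1 \<Rightarrow> 0)
                  | F1 \<Rightarrow> (case k of F1 \<Rightarrow> p1 | _ \<Rightarrow> 0))
   | E2 \<Rightarrow> (case j of E1 \<Rightarrow> (case k of E1 \<Rightarrow> c1 | E2 \<Rightarrow> c2 | F1 \<Rightarrow> 0)
                  | E2 \<Rightarrow> (case k of E1 \<Rightarrow> d1 | E2 \<Rightarrow> d2 | F1 \<Rightarrow> 0)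
                  | F1 \<Rightarrow> (case k of F1 \<Rightarrow> p2 | _ \<Rightarrow> 0))
   | F1 \<Rightarrow> (case j of E1 \<Rightarrow> (case k of F1 \<Rightarrow> q1 | _ \<Rightarrow> 0)
                  | E2 \<Rightarrow> (case k of F1 \<Rightarrow> q2 | _ \<Rightarrow> 0)
                  | F1 \<Rightarrow> (case k of E1 \<Rightarrow> s1 | E2 \<Rightarrow> s2 | F1 \<Rightarrow> 0)))"

lemma even_sc_eq_mk:
  assumes "even_sc c"
  shows "c = mk (c E1 E1 E1) (c E1 E1 E2) (c E1 E2 E1) (c E1 E2 E2) (c E2 E1 E1) (c E2 E1 E2)
    (c E2 E2 E1) (c E2 E2 E2) (c E1 F1 F1) (c E2 F1 F1) (c F1 E1 F1) (c F1 E2 F1) (c F1 F1 E1) (c F1 F1 E2)"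
  using assms unfolding even_sc_def by (simp add: mk_def fun_eq_iff all_idx)

lemma pmap_mk:
  assumes "a1 \<in> mpoly n" "a2 \<in> mpoly n" "b1 \<in> mpoly n" "b2 \<in> mpoly n" "c1 \<in> mpoly n" "c2 \<in> mpoly n"
    "d1 \<in> mpoly n" "d2 \<in> mpoly n" "p1 \<in> mpoly n" "p2 \<in> mpoly n" "q1 \<in> mpoly n" "q2 \<in> mpoly n"
    "s1 \<in> mpoly n" "s2 \<in> mpoly n"
  shows "pmap n (\<lambda>v. mk (a1 v) (a2 v) (b1 v) (b2 v) (c1 v) (c2 v) (d1 v) (d2 v)
    (p1 v) (p2 v) (q1 v) (q2 v) (s1 v) (s2 v))"
  using assms by (simp add: pmap_def mk_def all_idx mpoly.const)

definition bm :: "complex \<Rightarrow> complex \<Rightarrow> complex \<Rightarrow> complex \<Rightarrow> complex \<Rightarrow> idx \<Rightarrow> idx \<Rightarrow> complex" where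
  "bm a b c d m = (\<lambda>i j. case i of
     E1 \<Rightarrow> (case j of E1 \<Rightarrow> a | E2 \<Rightarrow> b | F1 \<Rightarrow> 0)
   | E2 \<Rightarrow> (case j of E1 \<Rightarrow> c | E2 \<Rightarrow> d | F1 \<Rightarrow> 0)
   | F1 \<Rightarrow> (case j of F1 \<Rightarrow> m | _ \<Rightarrow> 0))"

lemma even_mat_bm: "even_mat (bm a b c d m)"
  by (simp add: even_mat_def bm_def all_idx)

lemma even_mat_eq_bm: "even_mat g \<Longrightarrow> g = bm (g E1 E1) (g E1 E2) (g E2 E1) (g E2 E2) (g F1 F1)"
  by (simp add: even_mat_def bm_def all_idx fun_eq_iff)

lemma mat_mul_bm:
  "mat_mul (bm a b c d m) (bm a' b' c' d' m')
   = bm (a * a' + b * c') (a * b' + b * d') (c * a' + d * c') (c * b' + d * d') (m * m')"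
  by (simp add: mat_mul_def bm_def sum_idx fun_eq_iff all_idx)

lemma mat_one_bm: "mat_one = bm 1 0 0 1 1"
  by (simp add: mat_one_def bm_def fun_eq_iff all_idx)

lemma bm_eq_iff: "bm a b c d m = bm a' b' c' d' m' \<longleftrightarrow> a = a' \<and> b = b' \<and> c = c' \<and> d = d' \<and> m = m'"
  by (auto simp: bm_def fun_eq_iff all_idx)

definition binv :: "complex \<Rightarrow> complex \<Rightarrow> complex \<Rightarrow> complex \<Rightarrow> complex \<Rightarrow> idx \<Rightarrow> idx \<Rightarrow> complex" where
  "binv a b c d m = bm (d / (a * d - b * c)) (- b / (a * d - b * c)) (- c / (a * d - b * c)) (a / (a * d - b * c)) (1 / m)"

lemma binv_inverse:
  assumes "a * d - b * c \<noteq> 0" "m \<noteq> 0"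
  shows "mat_mul (binv a b c d m) (bm a b c d m) = mat_one" "mat_mul (bm a b c d m) (binv a b c d m) = mat_one"
  using assms by (simp_all add: binv_def mat_mul_bm mat_one_bm bm_eq_iff divide_simps)

lemma mat_inverse_unique: "mat_mul g h = mat_one \<Longrightarrow> mat_mul h g' = mat_one \<Longrightarrow> g = g'"
  by (metis mat_mul_assoc mat_mul_one)

text \<open>Orbits are parametrized by \<open>h\<close>, the inverse of \<open>g\<close>: its rows
  are the coordinate forms of the new structure, so a target structure suggests \<open>h\<close>
  directly, and Cramer's rule supplies \<open>g\<close>.\<close>

lemma orbit_bm:
  "orbit x = {act (binv a b c d m) (bm a b c d m) x | a b c d m. a * d - b * c \<noteq> 0 \<and> m \<noteq> 0}" (is "_ = ?R")
proof
  show "?R \<subseteq> orbit x"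
    unfolding orbit_def using binv_inverse even_mat_bm by (auto simp: binv_def) blast
  show "orbit x \<subseteq> ?R"
  proof
    fix y assume "y \<in> orbit x"
    then obtain g h where y: "y = act g h x" "even_mat g" "mat_mul g h = mat_one" "mat_mul h g = mat_one"
      unfolding orbit_def by auto
    define a b c d m where "a = h E1 E1" "b = h E1 E2" "c = h E2 E1" "d = h E2 E2" "m = h F1 F1"
    have h: "h = bm a b c d m"
      unfolding a_b_c_d_m_def by (rule even_mat_eq_bm[OF even_mat_inverse[OF y(2-4)]])
    define a' b' c' d' m' where "a' = g E1 E1" "b' = g E1 E2" "c' = g E2 E1" "d' = g E2 E2" "m' = g F1 F1"
    have g: "g = bm a' b' c' d' m'"
      unfolding a'_b'_c'_d'_m'_def by (rule even_mat_eq_bm[OF y(2)])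
    have "a * a' + b * c' = 1" "a * b' + b * d' = 0" "c * a' + d * c' = 0" "c * b' + d * d' = 1" "m * m' = 1"
      using y(4) unfolding g h mat_mul_bm mat_one_bm bm_eq_iff by auto
    then have "(a * d - b * c) * (a' * d' - b' * c') = 1" "m \<noteq> 0" by (algebra, auto)
    then have ne: "a * d - b * c \<noteq> 0" "m \<noteq> 0" by auto
    have "g = binv a b c d m"
      using mat_inverse_unique[OF y(3)] binv_inverse[OF ne] h by blast
    then show "y \<in> ?R" using y(1) h ne by blast
  qed
qed

lemma act_in_orbit:
  "act (binv a b c d m) (bm a b c d m) x = y \<Longrightarrow> a * d - b * c \<noteq> 0 \<Longrightarrow> m \<noteq> 0 \<Longrightarrow> y \<in> orbit x"
  unfolding orbit_bm by blast

text \<open>\<open>RA \<epsilon> \<eta>\<close> covers R01, R04, R02 and \<open>RC \<epsilon> \<eta>\<close> covers R25, R31, R33; here \<open>e1 f1 = \<epsilon> f1\<close> and \<open>f1 e1 = \<eta> f1\<close>.\<close>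

definition "RA \<epsilon> \<eta> = mk 1 0 0 0 0 0 0 1 \<epsilon> 0 \<eta> 0 0 0"
definition "RC \<epsilon> \<eta> = mk 1 0 0 0 0 1 0 0 \<epsilon> 0 \<eta> 0 0 0"

lemma R_eq_mk: "R01 = RA 0 0" "R02 = RA 1 1" "R04 = RA 0 1" "R25 = RC 0 0" "R31 = RC 0 1" "R33 = RC 1 1"
  "R10 = mk 1 0 0 0 0 0 0 0 0 0 0 0 0 1"
  by (simp_all add: R01_def R02_def R04_def R25_def R31_def R33_def R10_def RA_def RC_def mk_def sc_of_def
      fun_eq_iff all_idx)

lemma act_RA:
  "act (bm a b c d m) (bm x y z w n) (RA \<epsilon> \<eta>) =
   mk (a*x*x + b*z*z) (c*x*x + d*z*z) (a*x*y + b*z*w) (c*x*y + d*z*w)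
      (a*x*y + b*z*w) (c*x*y + d*z*w) (a*y*y + b*w*w) (c*y*y + d*w*w)
      (m*n*\<epsilon>*x) (m*n*\<epsilon>*y) (m*n*\<eta>*x) (m*n*\<eta>*y) 0 0"
  by (simp add: RA_def mk_def act_def bm_def sum_idx fun_eq_iff all_idx)

lemma act_RC:
  "act (bm a b c d m) (bm x y z w n) (RC \<epsilon> \<eta>) =
   mk (a*x*x + b*z*x) (c*x*x + d*z*x) (a*x*y + b*z*y) (c*x*y + d*z*y)
      (a*y*x + b*w*x) (c*y*x + d*w*x) (a*y*y + b*w*y) (c*y*y + d*w*y)
      (m*n*\<epsilon>*x) (m*n*\<epsilon>*y) (m*n*\<eta>*x) (m*n*\<eta>*y) 0 0"
  by (simp add: RC_def mk_def act_def bm_def sum_idx fun_eq_iff all_idx)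

lemma act_R10:
  "act (bm a b c d m) (bm x y z w n) R10 =
   mk (a*x*x) (c*x*x) (a*x*y) (c*x*y) (a*x*y) (c*x*y) (a*y*y) (c*y*y) 0 0 0 0 (b*n*n) (d*n*n)"
  by (simp add: R_eq_mk mk_def act_def bm_def sum_idx fun_eq_iff all_idx)

lemma mk_eqI:
  assumes "a1 = a1'" "a2 = a2'" "b1 = b1'" "b2 = b2'" "c1 = c1'" "c2 = c2'" "d1 = d1'" "d2 = d2'"
    "p1 = p1'" "p2 = p2'" "q1 = q1'" "q2 = q2'" "s1 = s1'" "s2 = s2'"
  shows "mk a1 a2 b1 b2 c1 c2 d1 d2 p1 p2 q1 q2 s1 s2 = mk a1' a2' b1' b2' c1' c2' d1' d2' p1' p2' q1' q2' s1' s2'"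
  using assms by simp

text \<open>For linear forms \<open>\<alpha>\<close>, \<open>\<beta>\<close> and \<open>s\<close> on the even part, \<open>famA\<close> is the commutative algebra with characters
  \<open>(\<beta> \<and> s) \<alpha>\<close> and \<open>(\<alpha> \<and> s) \<beta>\<close>.  The coordinates of \<open>v\<close> are \<open>\<alpha> = (v 4, v 0)\<close>, \<open>\<beta> = (v 5, v 1)\<close>, \<open>s = (v 2, v 3)\<close>;
  rescaling the forms achieves \<open>v 4 = v 5 = 1\<close> generically.\<close>

definition famA0 :: "complex \<Rightarrow> complex \<Rightarrow> complex \<Rightarrow> complex \<Rightarrow> complex \<Rightarrow> complex \<Rightarrow> complex \<Rightarrow> complex \<Rightarrow> sc" where
  "famA0 \<epsilon> \<eta> \<alpha>1 \<alpha>2 \<beta>1 \<beta>2 s1 s2 =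
    mk (\<alpha>1*\<beta>1*s2 - (\<alpha>1*\<beta>2 + \<alpha>2*\<beta>1)*s1) (\<alpha>1*\<beta>1*s1) (- \<alpha>2*\<beta>2*s1) (\<alpha>1*\<beta>1*s2)
       (- \<alpha>2*\<beta>2*s1) (\<alpha>1*\<beta>1*s2) (- \<alpha>2*\<beta>2*s2) ((\<alpha>1*\<beta>2 + \<alpha>2*\<beta>1)*s2 - \<alpha>2*\<beta>2*s1)
       (\<epsilon>*(\<beta>1*s2 - \<beta>2*s1)*\<alpha>1) (\<epsilon>*(\<beta>1*s2 - \<beta>2*s1)*\<alpha>2) (\<eta>*(\<beta>1*s2 - \<beta>2*s1)*\<alpha>1) (\<eta>*(\<beta>1*s2 - \<beta>2*s1)*\<alpha>2) 0 0"

definition "famA \<epsilon> \<eta> v = famA0 \<epsilon> \<eta> (v 4) (v 0) (v 5) (v 1) (v 2) (v 3)" for v :: "nat \<Rightarrow> complex"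

definition famB0 :: "complex \<Rightarrow> complex \<Rightarrow> complex \<Rightarrow> complex \<Rightarrow> complex \<Rightarrow> sc" where
  "famB0 \<chi>1 \<chi>2 u1 u2 \<tau> =
    mk (\<chi>1*\<chi>1*u1) (\<chi>1*\<chi>1*u2) (\<chi>1*\<chi>2*u1) (\<chi>1*\<chi>2*u2) (\<chi>1*\<chi>2*u1) (\<chi>1*\<chi>2*u2) (\<chi>2*\<chi>2*u1) (\<chi>2*\<chi>2*u2)
      0 0 0 0 (- \<tau>*\<chi>2) (\<tau>*\<chi>1)"

definition "famB v = famB0 (v 4) (v 0) (v 1) (v 2) (v 3)" for v :: "nat \<Rightarrow> complex"

definition famC0 :: "complex \<Rightarrow> complex \<Rightarrow> complex \<Rightarrow> complex \<Rightarrow> sc" where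
  "famC0 \<epsilon> \<eta> \<phi>1 \<phi>2 = mk \<phi>1 0 \<phi>2 0 0 \<phi>1 0 \<phi>2 (\<epsilon>*\<phi>1) (\<epsilon>*\<phi>2) (\<eta>*\<phi>1) (\<eta>*\<phi>2) 0 0"

definition "famC \<epsilon> \<eta> v = famC0 \<epsilon> \<eta> (v 0) (v 1)" for v :: "nat \<Rightarrow> complex"

text \<open>The forms x \<alpha> and y \<beta> below are the two characters of the even part. When
  they are independent they are the coordinate projections of an isomorphism with the product of two
  copies of the field, so they are taken as the rows of \<open>h\<close>. The odd actions are
  \<epsilon> and \<eta> times the first character, as in \<open>RA\<close>.\<close>

lemma famA0_in_orbit:
  assumes "\<alpha>1*\<beta>2 - \<alpha>2*\<beta>1 \<noteq> 0" "\<alpha>1*s2 - \<alpha>2*s1 \<noteq> 0" "\<beta>1*s2 - \<beta>2*s1 \<noteq> 0"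
  shows "famA0 \<epsilon> \<eta> \<alpha>1 \<alpha>2 \<beta>1 \<beta>2 s1 s2 \<in> orbit (RA \<epsilon> \<eta>)"
proof -
  define x y where "x = \<beta>1*s2 - \<beta>2*s1" and "y = \<alpha>1*s2 - \<alpha>2*s1"
  define e where "e = (x*\<alpha>1) * (y*\<beta>2) - (x*\<alpha>2) * (y*\<beta>1)"
  have e: "e = x*y*(\<alpha>1*\<beta>2 - \<alpha>2*\<beta>1)" by (simp add: e_def algebra_simps)
  have ne: "x \<noteq> 0" "y \<noteq> 0" "e \<noteq> 0" using assms unfolding e by (auto simp: x_def y_def)
  have "act (binv (x*\<alpha>1) (x*\<alpha>2) (y*\<beta>1) (y*\<beta>2) 1) (bm (x*\<alpha>1) (x*\<alpha>2) (y*\<beta>1) (y*\<beta>2) 1) (RA \<epsilon> \<eta>)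
     = famA0 \<epsilon> \<eta> \<alpha>1 \<alpha>2 \<beta>1 \<beta>2 s1 s2"
    unfolding binv_def e_def[symmetric] act_RA famA0_def
    by (intro mk_eqI; simp add: ne field_simps; simp add: e x_def y_def algebra_simps)
  moreover have "(x*\<alpha>1) * (y*\<beta>2) - (x*\<alpha>2) * (y*\<beta>1) \<noteq> 0" using ne by (simp add: e_def)
  ultimately show ?thesis by (rule act_in_orbit) simp
qed

text \<open>Put x = \<chi>(u). The idempotent is u / x^2. The first row of \<open>h\<close> is the
  multiple of \<chi> equal to 1 there; the second row kills u and is scaled to equal 1 on f1
  f1.\<close>

lemma famB0_in_orbit:
  assumes "\<chi>1*u1 + \<chi>2*u2 \<noteq> 0" "\<tau> \<noteq> 0"
  shows "famB0 \<chi>1 \<chi>2 u1 u2 \<tau> \<in> orbit R10"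
proof -
  define x where "x = \<chi>1*u1 + \<chi>2*u2"
  have ne: "x \<noteq> 0" "\<tau> \<noteq> 0" using assms by (auto simp: x_def)
  have e: "(x*\<chi>1) * (u1/(\<tau>*x)) - (x*\<chi>2) * (- u2/(\<tau>*x)) = x/\<tau>"
    using ne by (simp add: field_simps) (simp add: x_def algebra_simps)
  have "act (binv (x*\<chi>1) (x*\<chi>2) (- u2/(\<tau>*x)) (u1/(\<tau>*x)) 1) (bm (x*\<chi>1) (x*\<chi>2) (- u2/(\<tau>*x)) (u1/(\<tau>*x)) 1) R10
     = famB0 \<chi>1 \<chi>2 u1 u2 \<tau>"
    unfolding binv_def e act_R10 famB0_def
    by (intro mk_eqI; simp add: ne field_simps)
  moreover have "(x*\<chi>1) * (u1/(\<tau>*x)) - (x*\<chi>2) * (- u2/(\<tau>*x)) \<noteq> 0" using ne unfolding e by simp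
  ultimately show ?thesis by (rule act_in_orbit) simp
qed

text \<open>The product \<phi>(y) x refers to no basis, so any invertible matrix with first row
  \<phi> does.\<close>

lemma famC0_in_orbit:
  assumes "\<phi>1 \<noteq> 0 \<or> \<phi>2 \<noteq> 0"
  shows "famC0 \<epsilon> \<eta> \<phi>1 \<phi>2 \<in> orbit (RC \<epsilon> \<eta>)"
proof (cases "\<phi>1 = 0")
  case False
  then have "act (binv \<phi>1 \<phi>2 0 1 1) (bm \<phi>1 \<phi>2 0 1 1) (RC \<epsilon> \<eta>) = famC0 \<epsilon> \<eta> \<phi>1 \<phi>2"
    unfolding binv_def act_RC famC0_def by (intro mk_eqI; simp add: field_simps)
  moreover have "\<phi>1 * 1 - \<phi>2 * 0 \<noteq> 0" using False by simp
  ultimately show ?thesis by (rule act_in_orbit) simp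
next
  case True
  then have "act (binv \<phi>1 \<phi>2 1 0 1) (bm \<phi>1 \<phi>2 1 0 1) (RC \<epsilon> \<eta>) = famC0 \<epsilon> \<eta> \<phi>1 \<phi>2"
    using assms unfolding binv_def act_RC famC0_def by (intro mk_eqI; simp add: field_simps)
  moreover have "\<phi>1 * 0 - \<phi>2 * 1 \<noteq> 0" using True assms by simp
  ultimately show ?thesis by (rule act_in_orbit) simp
qed

subsection \<open>Solving the identities\<close>

lemma mult_mat_one: "mult c (mat_one i) (mat_one j) = c i j"
  by (cases i; cases j) (simp_all add: mult_def mat_one_def sum_idx fun_eq_iff)

lemma mult_mat_one_right: "mult c x (mat_one j) = (\<lambda>l. \<Sum>m\<in>UNIV. x m * c m j l)"
  by (cases j) (simp_all add: mult_def mat_one_def sum_idx fun_eq_iff)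

lemma mult_mat_one_left: "mult c (mat_one j) x = (\<lambda>l. \<Sum>m\<in>UNIV. x m * c j m l)"
  by (cases j) (simp_all add: mult_def mat_one_def sum_idx fun_eq_iff)

lemma homog_mat_one: "homog (mat_one i) (par i)"
  by (auto simp: homog_def mat_one_def)

lemma perm_basis:
  fixes c :: sc and A B :: "idx \<Rightarrow> idx \<Rightarrow> idx \<Rightarrow> idx \<Rightarrow> complex"
  assumes "is_perm c"
  defines "B \<equiv> \<lambda>i j k l. \<Sum>m\<in>UNIV. c i j m * c m k l"
  defines "A \<equiv> \<lambda>i j k l. B i j k l - (\<Sum>m\<in>UNIV. c j k m * c i m l)"
  shows "A i j k l = - sgn1 (par j \<and> par k) * A i k j l" (is ?t1)
    "A i j k l = - sgn1 (par i \<and> par j) * A j i k l" (is ?t2)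
    "B i j k l + sgn1 ((par i \<and> par j) \<noteq> ((par i \<and> par k) \<noteq> (par j \<and> par k))) * B k j i l
      = sgn1 (par j \<and> par k) * B i k j l + sgn1 ((par i \<and> par k) \<noteq> (par j \<and> par k)) * B k i j l" (is ?t3)
proof -
  have B: "mult c (mult c (mat_one i) (mat_one j)) (mat_one k) l = B i j k l" for i j k
    unfolding mult_mat_one unfolding B_def mult_mat_one_right ..
  have A: "assoc c (mat_one i) (mat_one j) (mat_one k) l = A i j k l" for i j k
    unfolding assoc_def mult_mat_one unfolding A_def B_def mult_mat_one_right mult_mat_one_left minus_apply ..
  note perm = assms(1)[unfolded is_perm_def, rule_format, of "mat_one i" "par i" "mat_one j" "par j" "mat_one k" "par k"]
  note perm' = perm[OF conjI[OF homog_mat_one conjI[OF homog_mat_one homog_mat_one]]]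
  show ?t1 using fun_cong[OF perm'[THEN conjunct1], of l] by (simp add: A smul_def)
  show ?t2 using fun_cong[OF perm'[THEN conjunct2, THEN conjunct1], of l] by (simp add: A smul_def)
  show ?t3 using fun_cong[OF perm'[THEN conjunct2, THEN conjunct2], of l] by (simp add: B smul_def)
qed

lemma sgn1_simps: "sgn1 True = -1" "sgn1 False = 1"
  by (simp_all add: sgn1_def)

text \<open>These say, in order: the even part is associative; its commutators are killed by left
  multiplication, recorded here for pairs of basis vectors; \<open>p\<close> and \<open>q\<close>
  are characters; \<open>p\<close> is zero or equal to \<open>q\<close>; f1 f1 is an eigenvector of
  left multiplications with eigenvalues \<open>q\<close> and of right multiplications with
  eigenvalues \<open>p\<close>; and \<open>p\<close> + \<open>q\<close> vanishes unless f1 f1 =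
  0.\<close>

lemma perm_equations:
  fixes c :: sc
  assumes "c \<in> PermVar"
  defines "p \<equiv> \<lambda>i. c i F1 F1" and "q \<equiv> \<lambda>i. c F1 i F1" and "s \<equiv> \<lambda>k. c F1 F1 k"
  assumes ev: "\<not> par i" "\<not> par j" "\<not> par k" "\<not> par l"
  shows "c i j E1 * c E1 k l + c i j E2 * c E2 k l = c j k E1 * c i E1 l + c j k E2 * c i E2 l" (is ?assoc)
    "c j i E1 * c i E1 l + c j i E2 * c i E2 l = c i j E1 * c i E1 l + c i j E2 * c i E2 l" (is ?comm)
    "p E1 * c i j E1 + p E2 * c i j E2 = p i * p j" (is ?p)
    "q E1 * c i j E1 + q E2 * c i j E2 = q i * q j" (is ?q)
    "p i * (p j - q j) = 0" (is ?pq)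
    "c i E1 l * s E1 + c i E2 l * s E2 = q i * s l" (is ?is)
    "c E1 i l * s E1 + c E2 i l * s E2 = p i * s l" (is ?si)
    "(p i + q i) * s l = 0" (is ?pqs)
proof -
  have perm: "is_perm c" and even: "even_sc c" using assms(1) by (auto simp: PermVar_def)
  have z: "c x y F1 = 0" "c x F1 y = 0" "c F1 x y = 0" if "\<not> par x" "\<not> par y" for x y
    using even that by (auto simp: even_sc_def)
  have z3: "c F1 F1 F1 = 0" using even by (simp add: even_sc_def)
  note b = perm_basis[OF perm, unfolded sum_idx]
  note S = sgn1_simps ev z z3 p_def q_def s_def
  define A where "A i j k l = (c i j E1 * c E1 k l + c i j E2 * c E2 k l) - (c j k E1 * c i E1 l + c j k E2 * c i E2 l)"
    for i j k l
  have A1: "A i j k l = - A i k j l" if "\<not> par i" "\<not> par j" "\<not> par k" "\<not> par l" for i j k l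
    using b(1)[of i j k l] that by (simp add: A_def S algebra_simps)
  have A2: "A i j k l = - A j i k l" if "\<not> par i" "\<not> par j" "\<not> par k" "\<not> par l" for i j k l
    using b(2)[of i j k l] that by (simp add: A_def S algebra_simps)
  have A0: "A i j j l = 0" "A i i j l = 0" "A i j i l = 0" if "\<not> par i" "\<not> par j" "\<not> par l" for i j l
    using A1[of i j j l] A2[of i i j l] A1[of i j i l] that by auto
  \<comment> \<open>An alternating associator with three arguments from two basis vectors has a
    repeated argument.\<close>
  have "i = j \<or> j = k \<or> i = k" using ev by (cases i; cases j; cases k) auto
  then have "A i j k l = 0"
    using A0(2)[OF ev(2,3,4)] A0(1)[OF ev(1,2,4)] A0(3)[OF ev(1,2,4)] by (elim disjE) simp_all
  then show ?assoc by (simp add: A_def)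
  \<comment> \<open>At (e_i, e_j, e_i) both sides of the third identity double up: (e_i e_j) e_i =
    (e_i e_i) e_j. Associativity moves the brackets.\<close>
  have "A i i j l = 0" "A i j i l = 0" using A0[OF ev(1,2,4)] by simp_all
  then have "2 * (c j i E1 * c i E1 l + c j i E2 * c i E2 l) = 2 * (c i j E1 * c i E1 l + c i j E2 * c i E2 l)"
    using b(3)[of i j i l] by (simp add: A_def S algebra_simps)
  then show ?comm by (simp only: mult_cancel_left) simp
  \<comment> \<open>The odd part is a line, so both actions are by commuting scalars and the
    associator (e_i, f1, e_j) vanishes.\<close>
  show ?p using b(1)[of i j F1 F1] by (simp add: S algebra_simps)
  show ?q using b(2)[of F1 i j F1] by (simp add: S algebra_simps)
  show ?pq using b(3)[of i j F1 F1] \<open>?p\<close> by (simp add: S algebra_simps) metis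
  show ?is using b(2)[of i F1 F1 l] b(1)[of F1 i F1 l] by (simp add: S algebra_simps)
  show si: ?si using b(2)[of i F1 F1 l] b(1)[of F1 i F1 l] by (simp add: S algebra_simps)
  show ?pqs using b(3)[of i F1 F1 l] si by (simp add: S algebra_simps)
qed

text \<open>The hypotheses are the vanishing 2x2 minors of the matrix with rows (b, d), (c, m), (P,
  Q). A row with a nonzero entry spans all rows; if the first two vanish, the third one
  does.\<close>

lemma rank_one_3x2:
  fixes b :: complex
  assumes "b*m = c*d" "b*Q = d*P" "m*P = c*Q"
  shows "\<exists>r1 r2 r3 s1 s2. b = r1*s1 \<and> d = r1*s2 \<and> c = r2*s1 \<and> m = r2*s2 \<and> P = r3*s1 \<and> Q = r3*s2"
proof -
  consider "b \<noteq> 0" | "d \<noteq> 0" | "c \<noteq> 0" | "m \<noteq> 0" | "b = 0 \<and> d = 0 \<and> c = 0 \<and> m = 0" by blast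
  then show ?thesis
  proof cases
    case 1
    show ?thesis by (rule exI[of _ 1], rule exI[of _ "c/b"], rule exI[of _ "P/b"], rule exI[of _ b], rule exI[of _ d]) (use 1 assms in \<open>auto simp: field_simps\<close>)
  next
    case 2
    show ?thesis by (rule exI[of _ 1], rule exI[of _ "m/d"], rule exI[of _ "Q/d"], rule exI[of _ b], rule exI[of _ d]) (use 2 assms in \<open>auto simp: field_simps\<close>)
  next
    case 3
    show ?thesis by (rule exI[of _ "b/c"], rule exI[of _ 1], rule exI[of _ "P/c"], rule exI[of _ c], rule exI[of _ m]) (use 3 assms in \<open>auto simp: field_simps\<close>)
  next
    case 4
    show ?thesis by (rule exI[of _ "d/m"], rule exI[of _ 1], rule exI[of _ "Q/m"], rule exI[of _ c], rule exI[of _ m]) (use 4 assms in \<open>auto simp: field_simps\<close>)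
  next
    case 5
    show ?thesis by (rule exI[of _ 0], rule exI[of _ 0], rule exI[of _ 1], rule exI[of _ P], rule exI[of _ Q]) (use 5 in auto)
  qed
qed

text \<open>A binary quadratic form over \<complex> splits into linear forms by a square root of its
  discriminant.\<close>

lemma binary_quadratic_factor:
  fixes A :: complex
  shows "\<exists>\<alpha>1 \<alpha>2 \<beta>1 \<beta>2. A = \<alpha>1*\<beta>1 \<and> B = \<alpha>1*\<beta>2 + \<alpha>2*\<beta>1 \<and> C = \<alpha>2*\<beta>2"
proof (cases "A = 0")
  case True
  show ?thesis by (rule exI[of _ 0], rule exI[of _ 1], rule exI[of _ B], rule exI[of _ C]) (use True in auto)
next
  case False
  define D where "D = csqrt (B\<^sup>2 - 4*A*C)"
  have D: "D*D = B*B - 4*A*C" unfolding D_def by (metis power2_csqrt power2_eq_square)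
  show ?thesis
    by (rule exI[of _ A], rule exI[of _ "(B+D)/2"], rule exI[of _ 1], rule exI[of _ "(B-D)/(2*A)"])
       (use False D in \<open>simp add: field_simps, algebra\<close>)
qed

text \<open>Here e1 e1 = (a, b), e1 e2 = e2 e1 = (c, d) and e2 e2 = (m, n). Associativity becomes
  the vanishing of the minors of the matrix with rows (b, d), (c, m), (a - d, c - n).\<close>

lemma commutative_param:
  fixes a :: complex
  assumes "d*c = b*m" "c*b + d*d = a*d + b*n" "m*a + n*c = c*c + d*m"
  shows "\<exists>\<alpha>1 \<alpha>2 \<beta>1 \<beta>2 s1 s2. a = \<alpha>1*\<beta>1*s2 - (\<alpha>1*\<beta>2 + \<alpha>2*\<beta>1)*s1 \<and> b = \<alpha>1*\<beta>1*s1 \<and>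
    c = - \<alpha>2*\<beta>2*s1 \<and> d = \<alpha>1*\<beta>1*s2 \<and> m = - \<alpha>2*\<beta>2*s2 \<and> n = (\<alpha>1*\<beta>2 + \<alpha>2*\<beta>1)*s2 - \<alpha>2*\<beta>2*s1"
proof -
  have "b*m = c*d" "b*(c - n) = d*(a - d)" "m*(a - d) = c*(c - n)"
    using assms by (simp_all add: algebra_simps) 
  from rank_one_3x2[OF this] obtain r1 r2 r3 s1 s2 where r:
    "b = r1*s1" "d = r1*s2" "c = r2*s1" "m = r2*s2" "a - d = r3*s1" "c - n = r3*s2" by blast
  obtain \<alpha>1 \<alpha>2 \<beta>1 \<beta>2 where "r1 = \<alpha>1*\<beta>1" "- r3 = \<alpha>1*\<beta>2 + \<alpha>2*\<beta>1" "- r2 = \<alpha>2*\<beta>2"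
    using binary_quadratic_factor[of r1 "- r3" "- r2"] by blast
  then have q: "r1 = \<alpha>1*\<beta>1" "r3 = - (\<alpha>1*\<beta>2 + \<alpha>2*\<beta>1)" "r2 = - \<alpha>2*\<beta>2"
    by (metis minus_minus) (metis minus_minus \<open>- r3 = _\<close>, metis minus_minus minus_mult_left \<open>- r2 = _\<close>)
  have "a = d + r3*s1" "n = c - r3*s2" using r(5,6) by (metis add.commute diff_add_cancel, simp add: algebra_simps)
  note an = this
  show ?thesis
    by (rule exI[of _ \<alpha>1], rule exI[of _ \<alpha>2], rule exI[of _ \<beta>1], rule exI[of _ \<beta>2],
        rule exI[of _ s1], rule exI[of _ s2]) (use an r(1-4) q in \<open>simp add: algebra_simps\<close>)
qed

text \<open>Let v be the determinant of \<beta> and q. It annihilates the difference of q and the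
  first character, so q either is that character or has v = 0; in the latter case the equations
  \<open>Y\<close> leave only zero and the second character.\<close>

lemma commutative_character:
  fixes q1 q2 :: complex
  assumes
    "(\<alpha>1*\<beta>1*s2 - (\<alpha>1*\<beta>2 + \<alpha>2*\<beta>1)*s1)*q1 + \<alpha>1*\<beta>1*s1*q2 = q1*q1"
    "- \<alpha>2*\<beta>2*s1*q1 + \<alpha>1*\<beta>1*s2*q2 = q1*q2"
    "- \<alpha>2*\<beta>2*s2*q1 + ((\<alpha>1*\<beta>2 + \<alpha>2*\<beta>1)*s2 - \<alpha>2*\<beta>2*s1)*q2 = q2*q2"
  shows "q1 = 0 \<and> q2 = 0 \<or> q1 = (\<beta>1*s2 - \<beta>2*s1)*\<alpha>1 \<and> q2 = (\<beta>1*s2 - \<beta>2*s1)*\<alpha>2 \<or>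
    q1 = (\<alpha>1*s2 - \<alpha>2*s1)*\<beta>1 \<and> q2 = (\<alpha>1*s2 - \<alpha>2*s1)*\<beta>2"
proof -
  define x1 x2 y1 y2 u v where d: "x1 = (\<beta>1*s2 - \<beta>2*s1)*\<alpha>1" "x2 = (\<beta>1*s2 - \<beta>2*s1)*\<alpha>2"
    "y1 = (\<alpha>1*s2 - \<alpha>2*s1)*\<beta>1" "y2 = (\<alpha>1*s2 - \<alpha>2*s1)*\<beta>2"
    "u = \<alpha>1*q2 - \<alpha>2*q1" "v = \<beta>1*q2 - \<beta>2*q1"
  have X: "q1*(q1 - x1) = s1*\<beta>1*u" "q1*(q2 - x2) = s2*\<beta>1*u" "q2*(q1 - x1) = s1*\<beta>2*u" "q2*(q2 - x2) = s2*\<beta>2*u"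
    using assms unfolding d by algebra+
  have Y: "q1*(q1 - y1) = s1*\<alpha>1*v" "q1*(q2 - y2) = s2*\<alpha>1*v" "q2*(q1 - y1) = s1*\<alpha>2*v" "q2*(q2 - y2) = s2*\<alpha>2*v"
    using assms unfolding d by algebra+
  have "v * (q1 - x1) = 0" "v * (q2 - x2) = 0"
    using X unfolding d(6) by algebra+
  then have "v = 0 \<or> q1 = x1 \<and> q2 = x2" by auto
  moreover have "q1 = 0 \<and> q2 = 0 \<or> q1 = y1 \<and> q2 = y2" if "v = 0"
    using Y that by auto
  ultimately show ?thesis unfolding d by blast
qed

text \<open>Let z = e1 e2 - e2 e1, which is nonzero. The equations \<open>w\<close> say that left
  multiplications kill z, and associativity on a repeated basis vector gives a2 z = 0 and d1 z = 0.
  Both basis vectors therefore square to multiples of themselves, and it remains to distinguish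
  which coordinate of z is nonzero.\<close>

lemma noncommutative_form:
  fixes a1 :: complex
  assumes ne: "b1 \<noteq> c1 \<or> b2 \<noteq> c2"
    and w: "b1*a1 + b2*b1 = c1*a1 + c2*b1" "b1*a2 + b2*b2 = c1*a2 + c2*b2"
      "b1*c1 + b2*d1 = c1*c1 + c2*d1" "b1*c2 + b2*d2 = c1*c2 + c2*d2"
    and as111: "a1*a1 + a2*c1 = a1*a1 + a2*b1" "a1*a2 + a2*c2 = a1*a2 + a2*b2"
    and as222: "d1*b1 + d2*d1 = d1*c1 + d2*d1" "d1*b2 + d2*d2 = d1*c2 + d2*d2"
    and as122: "b1*b1 + b2*d1 = d1*a1 + d2*b1"
    and as211: "c1*a2 + c2*c2 = a1*c2 + a2*d2"
  shows "a2 = 0 \<and> b2 = 0 \<and> c1 = 0 \<and> d1 = 0 \<and> c2 = a1 \<and> d2 = b1"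
proof -
  have "a2 * (b1 - c1) = 0" "a2 * (b2 - c2) = 0" using as111 by algebra+
  then have a2: "a2 = 0" using ne by auto
  have "d1 * (b1 - c1) = 0" "d1 * (b2 - c2) = 0" using as222 by algebra+
  then have d1: "d1 = 0" using ne by auto
  show ?thesis
  proof (cases "b1 = c1")
    case False
    have "(b1 - c1) * c1 = 0" using w(3) d1 by algebra
    then have c1: "c1 = 0" using False by simp
    then have b1: "b1 \<noteq> 0" using False by simp
    have "b1 * (d2 - b1) = 0" using as122 d1 by algebra
    then have d2: "d2 = b1" using b1 by simp
    have "b1 * b2 = 0" using w(4) c1 d2 by algebra
    then have b2: "b2 = 0" using b1 by simp
    have "b1 * (c2 - a1) = 0" using w(1) c1 b2 by algebra
    then show ?thesis using a2 d1 c1 d2 b1 b2 by simp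
  next
    case True
    then have w2: "b2 - c2 \<noteq> 0" using ne by simp
    have "(b2 - c2) * b2 = 0" using w(2) a2 by algebra
    then have b2: "b2 = 0" using w2 by simp
    then have c2: "c2 \<noteq> 0" using w2 by simp
    have "c2 * (c2 - a1) = 0" using as211 a2 by algebra
    then have a1: "c2 = a1" using c2 by simp
    have "c2 * b1 = 0" using w(1) True b2 by algebra
    then have b1: "b1 = 0" using c2 by simp
    have "c2 * d2 = 0" using w(4) True b2 by algebra
    then show ?thesis using a2 d1 a1 c2 b1 b2 True by simp
  qed
qed

section \<open>Assembling the classification\<close>

lemma famA0_range: "famA0 \<epsilon> \<eta> \<alpha>1 \<alpha>2 \<beta>1 \<beta>2 s1 s2 \<in> range (famA \<epsilon> \<eta>)"
  by (rule range_eqI[of _ _ "(\<lambda>_. 0)(4 := \<alpha>1, 0 := \<alpha>2, 5 := \<beta>1, 1 := \<beta>2, 2 := s1, 3 := s2)"])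
    (simp add: famA_def)

lemma famB0_range: "famB0 \<chi>1 \<chi>2 u1 u2 \<tau> \<in> range famB"
  by (rule range_eqI[of _ _ "(\<lambda>_. 0)(4 := \<chi>1, 0 := \<chi>2, 1 := u1, 2 := u2, 3 := \<tau>)"])
    (simp add: famB_def)

lemma famC0_range: "famC0 \<epsilon> \<eta> \<phi>1 \<phi>2 \<in> range (famC \<epsilon> \<eta>)"
  by (rule range_eqI[of _ _ "(\<lambda>_. 0)(0 := \<phi>1, 1 := \<phi>2)"]) (simp add: famC_def)

lemma character_pair:
  fixes p1 :: complex
  assumes pq: "p1 * (p1 - q1) = 0" "p1 * (p2 - q2) = 0" "p2 * (p1 - q1) = 0" "p2 * (p2 - q2) = 0"
  shows "p1 = 0 \<and> p2 = 0 \<or> p1 = q1 \<and> p2 = q2"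
  using assms by auto

lemma PermVar_cases:
  assumes "c \<in> PermVar"
  shows "c \<in> range (famA 0 0) \<union> range (famA 0 1) \<union> range (famA 1 1) \<union> range famB \<union>
    range (famC 0 0) \<union> range (famC 0 1) \<union> range (famC 1 1)"
proof -
  define a1 a2 b1 b2 c1 c2 d1 d2 where ev: "a1 = c E1 E1 E1" "a2 = c E1 E1 E2" "b1 = c E1 E2 E1" "b2 = c E1 E2 E2"
    "c1 = c E2 E1 E1" "c2 = c E2 E1 E2" "d1 = c E2 E2 E1" "d2 = c E2 E2 E2"
  define p1 p2 q1 q2 s1 s2 where od: "p1 = c E1 F1 F1" "p2 = c E2 F1 F1" "q1 = c F1 E1 F1" "q2 = c F1 E2 F1"
    "s1 = c F1 F1 E1" "s2 = c F1 F1 E2"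
  note d = ev[symmetric] od[symmetric]
  have c: "c = mk a1 a2 b1 b2 c1 c2 d1 d2 p1 p2 q1 q2 s1 s2"
    unfolding ev od using assms by (intro even_sc_eq_mk) (simp add: PermVar_def)
  have par: "\<not> par E1" "\<not> par E2" by simp_all
  note eqs = perm_equations[OF assms, unfolded d]
  have as111: "a1*a1 + a2*c1 = a1*a1 + a2*b1" "a1*a2 + a2*c2 = a1*a2 + a2*b2"
    using eqs(1)[of E1 E1 E1 E1, OF par(1,1,1,1)] eqs(1)[of E1 E1 E1 E2, OF par(1,1,1,2)] by (simp_all only: d)
  have as222: "d1*b1 + d2*d1 = d1*c1 + d2*d1" "d1*b2 + d2*d2 = d1*c2 + d2*d2"
    using eqs(1)[of E2 E2 E2 E1, OF par(2,2,2,1)] eqs(1)[of E2 E2 E2 E2, OF par(2,2,2,2)] by (simp_all only: d)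
  have as122: "b1*b1 + b2*d1 = d1*a1 + d2*b1" "b1*b2 + b2*d2 = d1*a2 + d2*b2"
    using eqs(1)[of E1 E2 E2 E1, OF par(1,2,2,1)] eqs(1)[of E1 E2 E2 E2, OF par(1,2,2,2)] by (simp_all only: d)
  have as211: "c1*a2 + c2*c2 = a1*c2 + a2*d2"
    using eqs(1)[of E2 E1 E1 E2, OF par(2,1,1,2)] by (simp_all only: d)
  have as112: "a1*b1 + a2*d1 = b1*a1 + b2*b1" "a1*b2 + a2*d2 = b1*a2 + b2*b2"
    using eqs(1)[of E1 E1 E2 E1, OF par(1,1,2,1)] eqs(1)[of E1 E1 E2 E2, OF par(1,1,2,2)] by (simp_all only: d)
  have w: "b1*a1 + b2*b1 = c1*a1 + c2*b1" "b1*a2 + b2*b2 = c1*a2 + c2*b2"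
      "b1*c1 + b2*d1 = c1*c1 + c2*d1" "b1*c2 + b2*d2 = c1*c2 + c2*d2"
    using eqs(2)[of E1 E2 E1 E1, OF par(1,2,1,1)] eqs(2)[of E1 E2 E1 E2, OF par(1,2,1,2)] eqs(2)[of E2 E1 E1 E1, OF par(2,1,1,1)] eqs(2)[of E2 E1 E1 E2, OF par(2,1,1,2)] by (simp_all only: d)
  have pc: "p1*a1 + p2*a2 = p1*p1" "p1*b1 + p2*b2 = p1*p2" "p1*c1 + p2*c2 = p2*p1" "p1*d1 + p2*d2 = p2*p2"
    using eqs(3)[of E1 E1, OF par(1,1,1,1)] eqs(3)[of E1 E2, OF par(1,2,1,1)]
      eqs(3)[of E2 E1, OF par(2,1,1,1)] eqs(3)[of E2 E2, OF par(2,2,1,1)] by (simp_all only: d)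
  have qc: "q1*a1 + q2*a2 = q1*q1" "q1*b1 + q2*b2 = q1*q2" "q1*c1 + q2*c2 = q2*q1" "q1*d1 + q2*d2 = q2*q2"
    using eqs(4)[of E1 E1, OF par(1,1,1,1)] eqs(4)[of E1 E2, OF par(1,2,1,1)]
      eqs(4)[of E2 E1, OF par(2,1,1,1)] eqs(4)[of E2 E2, OF par(2,2,1,1)] by (simp_all only: d)
  have pq: "p1 * (p1 - q1) = 0" "p1 * (p2 - q2) = 0" "p2 * (p1 - q1) = 0" "p2 * (p2 - q2) = 0"
    using eqs(5)[of E1 E1, OF par(1,1,1,1)] eqs(5)[of E1 E2, OF par(1,2,1,1)]
      eqs(5)[of E2 E1, OF par(2,1,1,1)] eqs(5)[of E2 E2, OF par(2,2,1,1)] by (simp_all only: d)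
  note pq' = character_pair[OF pq]
  have xs: "a1*s1 + b1*s2 = q1*s1" "a2*s1 + b2*s2 = q1*s2" "c1*s1 + d1*s2 = q2*s1" "c2*s1 + d2*s2 = q2*s2"
    using eqs(6)[of E1 E1 E1 E1, OF par(1,1,1,1)] eqs(6)[of E1 E1 E1 E2, OF par(1,1,1,2)]
      eqs(6)[of E2 E1 E1 E1, OF par(2,1,1,1)] eqs(6)[of E2 E1 E1 E2, OF par(2,1,1,2)] by (simp_all only: d)
  have sx: "a1*s1 + c1*s2 = p1*s1" "a2*s1 + c2*s2 = p1*s2" "b1*s1 + d1*s2 = p2*s1" "b2*s1 + d2*s2 = p2*s2"
    using eqs(7)[of E1 E1 E1 E1, OF par(1,1,1,1)] eqs(7)[of E1 E1 E1 E2, OF par(1,1,1,2)]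
      eqs(7)[of E2 E1 E1 E1, OF par(2,1,1,1)] eqs(7)[of E2 E1 E1 E2, OF par(2,1,1,2)] by (simp_all only: d)
  have ps: "(p1 + q1)*s1 = 0" "(p1 + q1)*s2 = 0" "(p2 + q2)*s1 = 0" "(p2 + q2)*s2 = 0"
    using eqs(8)[of E1 E1 E1 E1, OF par(1,1,1,1)] eqs(8)[of E1 E1 E1 E2, OF par(1,1,1,2)]
      eqs(8)[of E2 E1 E1 E1, OF par(2,1,1,1)] eqs(8)[of E2 E1 E1 E2, OF par(2,1,1,2)] by (simp_all only: d)
  \<comment> \<open>A nonzero f1 f1 forces p = - q, while p is 0 or q; both alternatives give p = q
    = 0.\<close>
  have odd0: "p1 = 0 \<and> p2 = 0 \<and> q1 = 0 \<and> q2 = 0" if "s1 \<noteq> 0 \<or> s2 \<noteq> 0"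
  proof -
    have "p1 + q1 = 0" "p2 + q2 = 0" using ps that by auto
    then show ?thesis using pq' by (auto simp: eq_neg_iff_add_eq_0[symmetric])
  qed
  show ?thesis
  proof (cases "b1 \<noteq> c1 \<or> b2 \<noteq> c2")
    case True
    note nf = noncommutative_form[OF True w as111 as222 as122(1) as211]
    then have ab: "a1 \<noteq> 0 \<or> b1 \<noteq> 0" using True by auto
    \<comment> \<open>Otherwise p = 0, so right multiplications kill f1 f1; but here right
      multiplication by y is the scalar \<phi>(y), and \<phi> is nonzero.\<close>
    have s: "s1 = 0 \<and> s2 = 0"
    proof (rule ccontr)
      assume s: "\<not> ?thesis"
      then have "p1 = 0" "p2 = 0" using odd0 by auto
      then show False using sx nf ab s by auto
    qed
    \<comment> \<open>Multiplicativity reads \<phi>(y) q(x) = q(x) q(y), so q is 0 or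
      \<phi>.\<close>
    have "q1 = 0 \<and> q2 = 0 \<or> q1 = a1 \<and> q2 = b1"
    proof -
      have "q1 * (q1 - a1) = 0" "q1 * (q2 - b1) = 0" "q2 * (q1 - a1) = 0" "q2 * (q2 - b1) = 0"
        using qc nf by (auto simp: algebra_simps)
      then show ?thesis by auto
    qed
    then have "c = famC0 0 0 a1 b1 \<or> c = famC0 0 1 a1 b1 \<or> c = famC0 1 1 a1 b1"
      using pq' s nf unfolding c famC0_def by auto
    then show ?thesis using famC0_range by auto
  next
    case False
    then have bc: "c1 = b1" "c2 = b2" by auto
    show ?thesis
    proof (cases "s1 = 0 \<and> s2 = 0")
      case False
      then have pq0: "p1 = 0" "p2 = 0" "q1 = 0" "q2 = 0" using odd0 by auto
      \<comment> \<open>The even part annihilates f1 f1, so the commutative product factors through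
        the form \<chi> = (s2, - s1) that vanishes on it. Then e2 e2 = s1^2 u determines u; if s2 is
        nonzero, e1 e1 = s2^2 u does.\<close>
      have "c = famB0 s2 (- s1) (d1/(s1*s1)) (d2/(s1*s1)) 1" if "s1 \<noteq> 0"
      proof -
        have "b1 = - s2*d1/s1" "b2 = - s2*d2/s1" using xs(3,4) pq0 bc that
          by (simp_all add: field_simps eq_neg_iff_add_eq_0)
        moreover have "a1 = - s2*b1/s1" "a2 = - s2*b2/s1" using xs(1,2) pq0 that
          by (simp_all add: field_simps eq_neg_iff_add_eq_0)
        ultimately show ?thesis
          unfolding c bc pq0 famB0_def by (intro mk_eqI; simp add: that)
      qed
      moreover have "c = famB0 s2 (- s1) (a1/(s2*s2)) (a2/(s2*s2)) 1" if "s2 \<noteq> 0"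
      proof -
        have "b1 = - s1*a1/s2" "b2 = - s1*a2/s2" using xs(1,2) pq0 that
          by (simp_all add: field_simps eq_neg_iff_add_eq_0 add.commute)
        moreover have "d1 = - s1*b1/s2" "d2 = - s1*b2/s2" using xs(3,4) pq0 bc that
          by (simp_all add: field_simps eq_neg_iff_add_eq_0 add.commute)
        ultimately show ?thesis
          unfolding c bc pq0 famB0_def by (intro mk_eqI; simp add: that)
      qed
      ultimately show ?thesis using False famB0_range by (metis UnCI)
    next
      case True
      have "b2*b1 = a2*d1" "b1*a2 + b2*b2 = a1*b2 + a2*d2" "d1*a1 + d2*b1 = b1*b1 + b2*d1"
        using as112 as122 by (simp_all add: algebra_simps)
      from commutative_param[OF this] obtain \<alpha>1 \<alpha>2 \<beta>1 \<beta>2 \<sigma>1 \<sigma>2 where par: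
        "a1 = \<alpha>1*\<beta>1*\<sigma>2 - (\<alpha>1*\<beta>2 + \<alpha>2*\<beta>1)*\<sigma>1" "a2 = \<alpha>1*\<beta>1*\<sigma>1" "b1 = - \<alpha>2*\<beta>2*\<sigma>1" "b2 = \<alpha>1*\<beta>1*\<sigma>2"
        "d1 = - \<alpha>2*\<beta>2*\<sigma>2" "d2 = (\<alpha>1*\<beta>2 + \<alpha>2*\<beta>1)*\<sigma>2 - \<alpha>2*\<beta>2*\<sigma>1" by blast
      \<comment> \<open>Exchanging \<alpha> and \<beta> preserves the even part and exchanges its
        two characters, so the second character leads to the same families.\<close>
      have swap: "c = mk (\<beta>1*\<alpha>1*\<sigma>2 - (\<beta>1*\<alpha>2 + \<beta>2*\<alpha>1)*\<sigma>1) (\<beta>1*\<alpha>1*\<sigma>1) (- \<beta>2*\<alpha>2*\<sigma>1) (\<beta>1*\<alpha>1*\<sigma>2)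
         (- \<beta>2*\<alpha>2*\<sigma>1) (\<beta>1*\<alpha>1*\<sigma>2) (- \<beta>2*\<alpha>2*\<sigma>2) ((\<beta>1*\<alpha>2 + \<beta>2*\<alpha>1)*\<sigma>2 - \<beta>2*\<alpha>2*\<sigma>1) p1 p2 q1 q2 0 0"
        unfolding c bc par using True by (intro mk_eqI; simp add: algebra_simps)
      have ch: "q1 = 0 \<and> q2 = 0 \<or> q1 = (\<beta>1*\<sigma>2 - \<beta>2*\<sigma>1)*\<alpha>1 \<and> q2 = (\<beta>1*\<sigma>2 - \<beta>2*\<sigma>1)*\<alpha>2 \<or>
        q1 = (\<alpha>1*\<sigma>2 - \<alpha>2*\<sigma>1)*\<beta>1 \<and> q2 = (\<alpha>1*\<sigma>2 - \<alpha>2*\<sigma>1)*\<beta>2"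
        using qc unfolding par by (intro commutative_character) (simp_all add: algebra_simps)
      have "c = famA0 0 0 \<alpha>1 \<alpha>2 \<beta>1 \<beta>2 \<sigma>1 \<sigma>2 \<or> c = famA0 0 1 \<alpha>1 \<alpha>2 \<beta>1 \<beta>2 \<sigma>1 \<sigma>2 \<or> c = famA0 1 1 \<alpha>1 \<alpha>2 \<beta>1 \<beta>2 \<sigma>1 \<sigma>2
        \<or> c = famA0 0 1 \<beta>1 \<beta>2 \<alpha>1 \<alpha>2 \<sigma>1 \<sigma>2 \<or> c = famA0 1 1 \<beta>1 \<beta>2 \<alpha>1 \<alpha>2 \<sigma>1 \<sigma>2"
        using ch
      proof (elim disjE)
        assume "q1 = 0 \<and> q2 = 0"
        then show ?thesis using pq' True unfolding c bc par famA0_def by auto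
      next
        assume "q1 = (\<beta>1*\<sigma>2 - \<beta>2*\<sigma>1)*\<alpha>1 \<and> q2 = (\<beta>1*\<sigma>2 - \<beta>2*\<sigma>1)*\<alpha>2"
        then show ?thesis using pq' True unfolding c bc par famA0_def by auto
      next
        assume "q1 = (\<alpha>1*\<sigma>2 - \<alpha>2*\<sigma>1)*\<beta>1 \<and> q2 = (\<alpha>1*\<sigma>2 - \<alpha>2*\<sigma>1)*\<beta>2"
        then show ?thesis using pq' unfolding swap famA0_def by auto
      qed
      then show ?thesis using famA0_range by auto
    qed
  qed
qed

subsection \<open>Open orbits\<close>

lemma orbit_bmE:
  assumes "y \<in> orbit X"
  obtains a b c d m x1 x2 z1 z2 n where "y = act (bm a b c d m) (bm x1 x2 z1 z2 n) X"
    "x1*a + x2*c = 1" "x1*b + x2*d = 0" "z1*a + z2*c = 0" "z1*b + z2*d = 1" "m*n = 1"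
    "x1*z2 - x2*z1 \<noteq> 0"
proof -
  obtain x1 x2 z1 z2 n where h: "x1*z2 - x2*z1 \<noteq> 0" "n \<noteq> 0"
    "y = act (binv x1 x2 z1 z2 n) (bm x1 x2 z1 z2 n) X"
    using assms unfolding orbit_bm by blast
  show ?thesis
    using that[OF h(3)[unfolded binv_def]] h(1,2) binv_inverse(2)[OF h(1,2)]
    unfolding binv_def mat_mul_bm mat_one_bm bm_eq_iff by simp
qed

text \<open>\<open>tr c i\<close> is the trace of left multiplication by the \<open>i\<close>-th basis vector on the even part, and
  \<open>disc\<close> is the determinant of the associated trace form.\<close>

definition tr :: "idx \<Rightarrow> sc \<Rightarrow> complex" where
  "tr i c = c i E1 E1 + c i E2 E2"

definition trf :: "idx \<Rightarrow> idx \<Rightarrow> sc \<Rightarrow> complex" where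
  "trf i j c = c i j E1 * tr E1 c + c i j E2 * tr E2 c"

definition disc :: "sc \<Rightarrow> complex" where
  "disc c = trf E1 E1 c * trf E2 E2 c - trf E1 E2 c * trf E2 E1 c"

text \<open>\<open>ltr\<close> and \<open>rtr\<close> are the determinants formed by the left,
  respectively right, odd action and the trace; they vanish when the two are proportional.\<close>

definition ltr :: "sc \<Rightarrow> complex" where "ltr c = c E1 F1 F1 * tr E2 c - c E2 F1 F1 * tr E1 c"
definition rtr :: "sc \<Rightarrow> complex" where "rtr c = c F1 E1 F1 * tr E2 c - c F1 E2 F1 * tr E1 c"
definition com :: "idx \<Rightarrow> sc \<Rightarrow> complex" where "com i c = c E1 E2 i - c E2 E1 i"

text \<open>Each set is to be the complement of one orbit. With disc = \<Delta>^2, ltr = \<epsilon>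
  \<Delta>, rtr = \<eta> \<Delta> on the first family, the first three test (1 - \<eta>^2)
  \<Delta>^2, \<epsilon> \<Delta> and (\<epsilon> - \<eta>) \<Delta>. On the third family trace and
  commutator are given by \<phi>, and the last three test \<eta> - 1, \<eta> - \<epsilon> and
  \<epsilon> times products of coordinates of \<phi>.\<close>

definition "Z01 = {c. disc c = rtr c * rtr c}"
definition "Z02 = {c. ltr c = 0}"
definition "Z04 = {c. ltr c = rtr c}"
definition "Z10 = {c. \<forall>i j. c F1 F1 i * tr j c = 0}"
definition "Z25 = {c. \<forall>i j. com i c * (c F1 j F1 - tr j c) = 0}"
definition "Z31 = {c. \<forall>i j. com i c * (c F1 j F1 - c j F1 F1) = 0}"
definition "Z33 = {c. \<forall>i j. com i c * c j F1 F1 = 0}"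

lemma zpoly_tr: "tr i \<in> zpoly" and zpoly_trf: "trf i j \<in> zpoly" and zpoly_disc: "disc \<in> zpoly"
  and zpoly_ltr: "ltr \<in> zpoly" and zpoly_rtr: "rtr \<in> zpoly" and zpoly_com: "com i \<in> zpoly"
proof -
  show t: "tr i \<in> zpoly" for i unfolding tr_def[abs_def] by (intro zpoly_intros)
  show tf: "trf i j \<in> zpoly" for i j unfolding trf_def[abs_def] by (intro zpoly_intros t)
  show "disc \<in> zpoly" unfolding disc_def[abs_def] by (intro zpoly_intros tf)
  show "ltr \<in> zpoly" unfolding ltr_def[abs_def] by (intro zpoly_intros t)
  show "rtr \<in> zpoly" unfolding rtr_def[abs_def] by (intro zpoly_intros t)
  show "com i \<in> zpoly" unfolding com_def[abs_def] by (intro zpoly_intros)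
qed

lemma zclosed_Z: "zclosed Z01" "zclosed Z02" "zclosed Z04" "zclosed Z10" "zclosed Z25" "zclosed Z31" "zclosed Z33"
  unfolding Z01_def Z02_def Z04_def Z10_def Z25_def Z31_def Z33_def
  by (intro zclosed_Collect_all zclosed_Collect_eq zpoly_intros zpoly_tr zpoly_disc zpoly_ltr zpoly_rtr zpoly_com)+

text \<open>The trace is the sum of the two characters, so the trace form is a Gram matrix in them;
  its determinant is the square of the determinant \<Delta> of the characters.\<close>

lemma inv_famA0:
  fixes \<alpha>1 \<alpha>2 \<beta>1 \<beta>2 s1 s2 :: complex
  defines "\<Delta> \<equiv> (\<alpha>1*\<beta>2 - \<alpha>2*\<beta>1) * (\<alpha>1*s2 - \<alpha>2*s1) * (\<beta>1*s2 - \<beta>2*s1)"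
  shows "disc (famA0 \<epsilon> \<eta> \<alpha>1 \<alpha>2 \<beta>1 \<beta>2 s1 s2) = \<Delta>*\<Delta>"
    "ltr (famA0 \<epsilon> \<eta> \<alpha>1 \<alpha>2 \<beta>1 \<beta>2 s1 s2) = \<epsilon>*\<Delta>" "rtr (famA0 \<epsilon> \<eta> \<alpha>1 \<alpha>2 \<beta>1 \<beta>2 s1 s2) = \<eta>*\<Delta>"
    "com i (famA0 \<epsilon> \<eta> \<alpha>1 \<alpha>2 \<beta>1 \<beta>2 s1 s2) = 0" "famA0 \<epsilon> \<eta> \<alpha>1 \<alpha>2 \<beta>1 \<beta>2 s1 s2 F1 F1 i = 0"
proof -
  define x y where x: "x = \<beta>1*s2 - \<beta>2*s1" and y: "y = \<alpha>1*s2 - \<alpha>2*s1"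
  let ?c = "famA0 \<epsilon> \<eta> \<alpha>1 \<alpha>2 \<beta>1 \<beta>2 s1 s2"
  have D: "\<Delta> = (\<alpha>1*\<beta>2 - \<alpha>2*\<beta>1) * y * x" by (simp add: \<Delta>_def x y)
  have t: "tr E1 ?c = x*\<alpha>1 + y*\<beta>1" "tr E2 ?c = x*\<alpha>2 + y*\<beta>2"
    by (simp_all add: tr_def famA0_def mk_def x y algebra_simps)
  have "trf E1 E1 ?c = x*\<alpha>1*(x*\<alpha>1) + y*\<beta>1*(y*\<beta>1)" "trf E1 E2 ?c = x*\<alpha>1*(x*\<alpha>2) + y*\<beta>1*(y*\<beta>2)"
    "trf E2 E1 ?c = x*\<alpha>1*(x*\<alpha>2) + y*\<beta>1*(y*\<beta>2)" "trf E2 E2 ?c = x*\<alpha>2*(x*\<alpha>2) + y*\<beta>2*(y*\<beta>2)"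
    unfolding trf_def t by (simp_all add: famA0_def mk_def x y algebra_simps)
  then show "disc ?c = \<Delta>*\<Delta>" unfolding disc_def D by (simp add: algebra_simps)
  show "ltr ?c = \<epsilon>*\<Delta>" "rtr ?c = \<eta>*\<Delta>"
    unfolding ltr_def rtr_def t D by (simp_all add: famA0_def mk_def x[symmetric] algebra_simps)
  show "com i ?c = 0" "?c F1 F1 i = 0" by (cases i; simp add: com_def famA0_def mk_def)+
qed

lemma inv_famB0:
  "disc (famB0 \<chi>1 \<chi>2 u1 u2 \<tau>) = 0" "ltr (famB0 \<chi>1 \<chi>2 u1 u2 \<tau>) = 0" "rtr (famB0 \<chi>1 \<chi>2 u1 u2 \<tau>) = 0"
  "com i (famB0 \<chi>1 \<chi>2 u1 u2 \<tau>) = 0"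
  "tr E1 (famB0 \<chi>1 \<chi>2 u1 u2 \<tau>) = \<chi>1*(\<chi>1*u1 + \<chi>2*u2)" "tr E2 (famB0 \<chi>1 \<chi>2 u1 u2 \<tau>) = \<chi>2*(\<chi>1*u1 + \<chi>2*u2)"
  "tr F1 (famB0 \<chi>1 \<chi>2 u1 u2 \<tau>) = 0"
  "famB0 \<chi>1 \<chi>2 u1 u2 \<tau> F1 F1 E1 = - \<tau>*\<chi>2" "famB0 \<chi>1 \<chi>2 u1 u2 \<tau> F1 F1 E2 = \<tau>*\<chi>1"
  "famB0 \<chi>1 \<chi>2 u1 u2 \<tau> F1 F1 F1 = 0"
proof -
  let ?c = "famB0 \<chi>1 \<chi>2 u1 u2 \<tau>"
  show t: "tr E1 ?c = \<chi>1*(\<chi>1*u1 + \<chi>2*u2)" "tr E2 ?c = \<chi>2*(\<chi>1*u1 + \<chi>2*u2)"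
    by (simp_all add: tr_def famB0_def mk_def algebra_simps)
  show "disc ?c = 0"
    unfolding disc_def trf_def t by (simp add: famB0_def mk_def algebra_simps)
  show "ltr ?c = 0" "rtr ?c = 0" "tr F1 ?c = 0" by (simp_all add: ltr_def rtr_def tr_def famB0_def mk_def)
  show "com i ?c = 0" by (cases i; simp add: com_def famB0_def mk_def)
qed (simp_all add: famB0_def mk_def)

lemma inv_famC0:
  "disc (famC0 \<epsilon> \<eta> \<phi>1 \<phi>2) = 0" "ltr (famC0 \<epsilon> \<eta> \<phi>1 \<phi>2) = 0" "rtr (famC0 \<epsilon> \<eta> \<phi>1 \<phi>2) = 0"
  "com E1 (famC0 \<epsilon> \<eta> \<phi>1 \<phi>2) = \<phi>2" "com E2 (famC0 \<epsilon> \<eta> \<phi>1 \<phi>2) = - \<phi>1" "com F1 (famC0 \<epsilon> \<eta> \<phi>1 \<phi>2) = 0"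
  "tr E1 (famC0 \<epsilon> \<eta> \<phi>1 \<phi>2) = \<phi>1" "tr E2 (famC0 \<epsilon> \<eta> \<phi>1 \<phi>2) = \<phi>2" "tr F1 (famC0 \<epsilon> \<eta> \<phi>1 \<phi>2) = 0"
  "famC0 \<epsilon> \<eta> \<phi>1 \<phi>2 F1 F1 i = 0"
  "famC0 \<epsilon> \<eta> \<phi>1 \<phi>2 E1 F1 F1 = \<epsilon>*\<phi>1" "famC0 \<epsilon> \<eta> \<phi>1 \<phi>2 E2 F1 F1 = \<epsilon>*\<phi>2"
  "famC0 \<epsilon> \<eta> \<phi>1 \<phi>2 F1 E1 F1 = \<eta>*\<phi>1" "famC0 \<epsilon> \<eta> \<phi>1 \<phi>2 F1 E2 F1 = \<eta>*\<phi>2"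
  by (cases i; simp add: disc_def trf_def ltr_def rtr_def tr_def com_def famC0_def mk_def)+

text \<open>The witness \<Delta> is the determinant of the even block of \<open>h\<close>, whose
  rows are the two characters.\<close>

lemma inv_orbit_RA:
  assumes "c \<in> orbit (RA \<epsilon> \<eta>)"
  shows "\<exists>\<Delta>. \<Delta> \<noteq> 0 \<and> disc c = \<Delta>*\<Delta> \<and> ltr c = \<epsilon>*\<Delta> \<and> rtr c = \<eta>*\<Delta>"
proof -
  obtain a b d e m x1 x2 z1 z2 n where c: "c = act (bm a b d e m) (bm x1 x2 z1 z2 n) (RA \<epsilon> \<eta>)"
    and i: "x1*a + x2*d = 1" "x1*b + x2*e = 0" "z1*a + z2*d = 0" "z1*b + z2*e = 1" "m*n = 1"
    and ne: "x1*z2 - x2*z1 \<noteq> 0"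
    using assms by (rule orbit_bmE)
  have t: "tr E1 c = x1 + z1" "tr E2 c = x2 + z2"
    using i(1-4) by (simp_all add: tr_def c act_RA mk_def) algebra+
  have "trf E1 E1 c = x1*x1 + z1*z1" "trf E1 E2 c = x1*x2 + z1*z2"
    "trf E2 E1 c = x1*x2 + z1*z2" "trf E2 E2 c = x2*x2 + z2*z2"
    unfolding trf_def t using i(1-4) by (simp_all add: c act_RA mk_def) algebra+
  then have "disc c = (x1*z2 - x2*z1)*(x1*z2 - x2*z1)" by (simp add: disc_def algebra_simps)
  moreover have "ltr c = \<epsilon>*(x1*z2 - x2*z1)" "rtr c = \<eta>*(x1*z2 - x2*z1)"
    unfolding ltr_def rtr_def t using i(5) by (simp_all add: c act_RA mk_def algebra_simps)
  ultimately show ?thesis using ne by blast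
qed

lemma orbit_R10_not_in_Z10:
  assumes "c \<in> orbit R10" shows "c \<notin> Z10"
proof
  obtain a b d e m x1 x2 z1 z2 n where c: "c = act (bm a b d e m) (bm x1 x2 z1 z2 n) R10"
    and i: "x1*a + x2*d = 1" "x1*b + x2*e = 0" "z1*a + z2*d = 0" "z1*b + z2*e = 1" "m*n = 1"
    and ne: "x1*z2 - x2*z1 \<noteq> 0"
    using assms by (rule orbit_bmE)
  have t: "tr E1 c = x1" "tr E2 c = x2"
    using i(1-4) by (simp_all add: tr_def c act_R10 mk_def) algebra+
  have s: "c F1 F1 E1 = b*n*n" "c F1 F1 E2 = e*n*n" by (simp_all add: c act_R10 mk_def)
  assume "c \<in> Z10"
  then have "b*n*n*x1 = 0" "b*n*n*x2 = 0" "e*n*n*x1 = 0" "e*n*n*x2 = 0"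
    unfolding Z10_def by (auto simp flip: s t)
  moreover have "n \<noteq> 0" using i(5) by auto
  moreover have "b \<noteq> 0 \<or> e \<noteq> 0" using i(4) by auto
  moreover have "x1 \<noteq> 0 \<or> x2 \<noteq> 0" using i(1) by auto
  ultimately show False by auto
qed

lemma orbit_RC_range: 
  assumes "c \<in> orbit (RC \<epsilon> \<eta>)" shows "\<exists>\<phi>1 \<phi>2. (\<phi>1 \<noteq> 0 \<or> \<phi>2 \<noteq> 0) \<and> c = famC0 \<epsilon> \<eta> \<phi>1 \<phi>2"
proof -
  obtain a b d e m x1 x2 z1 z2 n where c: "c = act (bm a b d e m) (bm x1 x2 z1 z2 n) (RC \<epsilon> \<eta>)"
    and i: "x1*a + x2*d = 1" "x1*b + x2*e = 0" "z1*a + z2*d = 0" "z1*b + z2*e = 1" "m*n = 1"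
    and ne: "x1*z2 - x2*z1 \<noteq> 0"
    using assms by (rule orbit_bmE)
  \<comment> \<open>The relations so far express h g = 1; the nonzero determinant turns them into g
    h = 1.\<close>
  have g: "a*x1 + b*z1 = 1" "a*x2 + b*z2 = 0" "d*x1 + e*z1 = 0" "d*x2 + e*z2 = 1"
  proof -
    have "(x1*z2 - x2*z1) * (a*x1 + b*z1 - 1) = 0" "(x1*z2 - x2*z1) * (a*x2 + b*z2) = 0"
      "(x1*z2 - x2*z1) * (d*x1 + e*z1) = 0" "(x1*z2 - x2*z1) * (d*x2 + e*z2 - 1) = 0"
      using i(1-4) by algebra+
    then show "a*x1 + b*z1 = 1" "a*x2 + b*z2 = 0" "d*x1 + e*z1 = 0" "d*x2 + e*z2 = 1" using ne by auto
  qed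
  have "c = famC0 \<epsilon> \<eta> x1 x2"
    unfolding c act_RC famC0_def by (rule mk_eqI; (rule refl | use g i(5) in algebra))
  moreover have "x1 \<noteq> 0 \<or> x2 \<noteq> 0" using i(1) by auto
  ultimately show ?thesis by blast
qed

lemma PermVar_casesE:
  assumes "c \<in> PermVar"
  obtains (A) \<epsilon> \<eta> \<alpha>1 \<alpha>2 \<beta>1 \<beta>2 s1 s2 where "(\<epsilon>, \<eta>) \<in> {(0,0),(0,1),(1,1)}" "c = famA0 \<epsilon> \<eta> \<alpha>1 \<alpha>2 \<beta>1 \<beta>2 s1 s2"
  | (B) \<chi>1 \<chi>2 u1 u2 \<tau> where "c = famB0 \<chi>1 \<chi>2 u1 u2 \<tau>"
  | (C) \<epsilon> \<eta> \<phi>1 \<phi>2 where "(\<epsilon>, \<eta>) \<in> {(0,0),(0,1),(1,1)}" "c = famC0 \<epsilon> \<eta> \<phi>1 \<phi>2"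
proof -
  from PermVar_cases[OF assms] consider
    v where "c = famA 0 0 v" | v where "c = famA 0 1 v" | v where "c = famA 1 1 v" | v where "c = famB v"
    | v where "c = famC 0 0 v" | v where "c = famC 0 1 v" | v where "c = famC 1 1 v" by auto
  then show ?thesis
  proof cases
    case (1 v) show ?thesis by (rule A[OF _ 1[unfolded famA_def]]) simp
  next
    case (2 v) show ?thesis by (rule A[OF _ 2[unfolded famA_def]]) simp
  next
    case (3 v) show ?thesis by (rule A[OF _ 3[unfolded famA_def]]) simp
  next
    case (4 v) show ?thesis by (rule B[OF 4[unfolded famB_def]])
  next
    case (5 v) show ?thesis by (rule C[OF _ 5[unfolded famC_def]]) simp
  next
    case (6 v) show ?thesis by (rule C[OF _ 6[unfolded famC_def]]) simp
  next
    case (7 v) show ?thesis by (rule C[OF _ 7[unfolded famC_def]]) simp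
  qed
qed

lemma famA0_generic:
  assumes "disc (famA0 \<epsilon> \<eta> \<alpha>1 \<alpha>2 \<beta>1 \<beta>2 s1 s2) \<noteq> 0"
  shows "famA0 \<epsilon> \<eta> \<alpha>1 \<alpha>2 \<beta>1 \<beta>2 s1 s2 \<in> orbit (RA \<epsilon> \<eta>) \<inter> range (famA \<epsilon> \<eta>)"
  using assms unfolding inv_famA0 by (auto intro!: famA0_in_orbit famA0_range)

lemma famC0_generic:
  assumes "\<phi>1 \<noteq> 0 \<or> \<phi>2 \<noteq> 0"
  shows "famC0 \<epsilon> \<eta> \<phi>1 \<phi>2 \<in> orbit (RC \<epsilon> \<eta>) \<inter> range (famC \<epsilon> \<eta>)"
  using assms by (auto intro!: famC0_in_orbit famC0_range)

section \<open>The representatives satisfy the identities\<close>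

lemma mult_RA: "mult (RA \<epsilon> \<eta>) x y =
    (\<lambda>k. case k of E1 \<Rightarrow> x E1 * y E1 | E2 \<Rightarrow> x E2 * y E2 | F1 \<Rightarrow> \<epsilon> * x E1 * y F1 + \<eta> * x F1 * y E1)"
  by (simp add: mult_def RA_def mk_def sum_idx fun_eq_iff all_idx)

lemma mult_RC: "mult (RC \<epsilon> \<eta>) x y =
    (\<lambda>k. case k of E1 \<Rightarrow> x E1 * y E1 | E2 \<Rightarrow> x E2 * y E1 | F1 \<Rightarrow> \<epsilon> * x E1 * y F1 + \<eta> * x F1 * y E1)"
  by (simp add: mult_def RC_def mk_def sum_idx fun_eq_iff all_idx)

lemma mult_R10: "mult R10 x y =
    (\<lambda>k. case k of E1 \<Rightarrow> x E1 * y E1 | E2 \<Rightarrow> x F1 * y F1 | F1 \<Rightarrow> 0)"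
  by (simp add: mult_def R_eq_mk mk_def sum_idx fun_eq_iff all_idx)

lemma homog_idx: "homog x d \<longleftrightarrow> (if d then x E1 = 0 \<and> x E2 = 0 else x F1 = 0)"
  by (auto simp: homog_def all_idx)

lemma even_sc_mk: "even_sc (mk a1 a2 b1 b2 c1 c2 d1 d2 p1 p2 q1 q2 s1 s2)"
  by (simp add: even_sc_def mk_def all_idx)

lemma even_sc_reps: "even_sc (RA \<epsilon> \<eta>)" "even_sc (RC \<epsilon> \<eta>)" "even_sc R10"
  by (simp_all add: RA_def RC_def R_eq_mk(7) even_sc_mk)

lemma RA_in_PermVar: "(\<epsilon>, \<eta>) \<in> {(0,0),(0,1),(1,1)} \<Longrightarrow> RA \<epsilon> \<eta> \<in> PermVar"
  unfolding PermVar_def is_perm_def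
  by (auto simp: even_sc_reps mult_RA assoc_def smul_def fun_eq_iff all_idx sgn1_def homog_idx split: if_splits)

lemma RC_in_PermVar: "(\<epsilon>, \<eta>) \<in> {(0,0),(0,1),(1,1)} \<Longrightarrow> RC \<epsilon> \<eta> \<in> PermVar"
  unfolding PermVar_def is_perm_def
  by (auto simp: even_sc_reps mult_RC assoc_def smul_def fun_eq_iff all_idx sgn1_def homog_idx split: if_splits)

lemma R10_in_PermVar: "R10 \<in> PermVar"
  unfolding PermVar_def is_perm_def
  by (auto simp: even_sc_reps mult_R10 assoc_def smul_def fun_eq_iff all_idx sgn1_def homog_idx split: if_splits)


text \<open>All seven inclusions are proved together so that each normal form is inspected once: it
  lies in every closed set belonging to another kind, and outside one of its own kind its parameters
  are generic and (\<epsilon>, \<eta>) is determined. The range on the right is recorded to obtain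
  later that each orbit lies in its family.\<close>

lemma PermVar_minus_Z:
  "PermVar - Z01 \<subseteq> orbit R01 \<inter> range (famA 0 0)"
  "PermVar - Z02 \<subseteq> orbit R02 \<inter> range (famA 1 1)"
  "PermVar - Z04 \<subseteq> orbit R04 \<inter> range (famA 0 1)"
  "PermVar - Z10 \<subseteq> orbit R10 \<inter> range famB"
  "PermVar - Z25 \<subseteq> orbit R25 \<inter> range (famC 0 0)"
  "PermVar - Z31 \<subseteq> orbit R31 \<inter> range (famC 0 1)"
  "PermVar - Z33 \<subseteq> orbit R33 \<inter> range (famC 1 1)"
proof -
  have "(c \<notin> Z01 \<longrightarrow> c \<in> orbit R01 \<inter> range (famA 0 0)) \<and>
     (c \<notin> Z02 \<longrightarrow> c \<in> orbit R02 \<inter> range (famA 1 1)) \<and>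
     (c \<notin> Z04 \<longrightarrow> c \<in> orbit R04 \<inter> range (famA 0 1)) \<and>
     (c \<notin> Z10 \<longrightarrow> c \<in> orbit R10 \<inter> range famB) \<and>
     (c \<notin> Z25 \<longrightarrow> c \<in> orbit R25 \<inter> range (famC 0 0)) \<and>
     (c \<notin> Z31 \<longrightarrow> c \<in> orbit R31 \<inter> range (famC 0 1)) \<and>
     (c \<notin> Z33 \<longrightarrow> c \<in> orbit R33 \<inter> range (famC 1 1))" (is "?P c") if "c \<in> PermVar" for c
    using that
  proof (cases rule: PermVar_casesE)
    case (A \<epsilon> \<eta> \<alpha>1 \<alpha>2 \<beta>1 \<beta>2 s1 s2)
    have "c \<in> Z10" "c \<in> Z25" "c \<in> Z31" "c \<in> Z33"
      unfolding Z10_def Z25_def Z31_def Z33_def A(2) by (simp_all add: inv_famA0)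
    moreover have "disc c \<noteq> 0 \<Longrightarrow> c \<in> orbit (RA \<epsilon> \<eta>) \<inter> range (famA \<epsilon> \<eta>)"
      unfolding A(2) by (rule famA0_generic)
    moreover have "c \<notin> Z01 \<Longrightarrow> disc c \<noteq> 0 \<and> \<epsilon> = 0 \<and> \<eta> = 0" "c \<notin> Z02 \<Longrightarrow> disc c \<noteq> 0 \<and> \<epsilon> = 1 \<and> \<eta> = 1"
      "c \<notin> Z04 \<Longrightarrow> disc c \<noteq> 0 \<and> \<epsilon> = 0 \<and> \<eta> = 1"
      unfolding Z01_def Z02_def Z04_def A(2) mem_Collect_eq inv_famA0 using A(1) by auto
    ultimately show "?P c" unfolding R_eq_mk(1-6) by auto
  next
    case (B \<chi>1 \<chi>2 u1 u2 \<tau>)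
    have "c \<in> Z01" "c \<in> Z02" "c \<in> Z04" "c \<in> Z25" "c \<in> Z31" "c \<in> Z33"
      unfolding Z01_def Z02_def Z04_def Z25_def Z31_def Z33_def B by (simp_all add: inv_famB0)
    moreover have "\<chi>1*u1 + \<chi>2*u2 \<noteq> 0 \<and> \<tau> \<noteq> 0" if "c \<notin> Z10"
      using that unfolding Z10_def B by (auto simp: inv_famB0 all_idx)
    then have "c \<notin> Z10 \<Longrightarrow> c \<in> orbit R10 \<inter> range famB"
      unfolding B using famB0_in_orbit famB0_range by blast
    ultimately show "?P c" by blast
  next
    case (C \<epsilon> \<eta> \<phi>1 \<phi>2)
    have "c \<in> Z01" "c \<in> Z02" "c \<in> Z04" "c \<in> Z10"
      unfolding Z01_def Z02_def Z04_def Z10_def C(2) by (simp_all add: inv_famC0)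
    moreover have "\<phi>1 \<noteq> 0 \<or> \<phi>2 \<noteq> 0 \<Longrightarrow> c \<in> orbit (RC \<epsilon> \<eta>) \<inter> range (famC \<epsilon> \<eta>)"
      unfolding C(2) by (rule famC0_generic)
    moreover have "c \<notin> Z25 \<Longrightarrow> (\<phi>1 \<noteq> 0 \<or> \<phi>2 \<noteq> 0) \<and> \<epsilon> = 0 \<and> \<eta> = 0"
      "c \<notin> Z31 \<Longrightarrow> (\<phi>1 \<noteq> 0 \<or> \<phi>2 \<noteq> 0) \<and> \<epsilon> = 0 \<and> \<eta> = 1"
      "c \<notin> Z33 \<Longrightarrow> (\<phi>1 \<noteq> 0 \<or> \<phi>2 \<noteq> 0) \<and> \<epsilon> = 1 \<and> \<eta> = 1"
      unfolding Z25_def Z31_def Z33_def C(2) mem_Collect_eq all_idx inv_famC0 using C(1)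
      by (auto simp: inv_famC0)
    ultimately show "?P c" unfolding R_eq_mk(1-6) by auto
  qed
  then show
    "PermVar - Z01 \<subseteq> orbit R01 \<inter> range (famA 0 0)"
    "PermVar - Z02 \<subseteq> orbit R02 \<inter> range (famA 1 1)"
    "PermVar - Z04 \<subseteq> orbit R04 \<inter> range (famA 0 1)"
    "PermVar - Z10 \<subseteq> orbit R10 \<inter> range famB"
    "PermVar - Z25 \<subseteq> orbit R25 \<inter> range (famC 0 0)"
    "PermVar - Z31 \<subseteq> orbit R31 \<inter> range (famC 0 1)"
    "PermVar - Z33 \<subseteq> orbit R33 \<inter> range (famC 1 1)" by blast+
qed

lemma orbit_disjoint_Z:
  "orbit R01 \<inter> Z01 = {}" "orbit R02 \<inter> Z02 = {}" "orbit R04 \<inter> Z04 = {}" "orbit R10 \<inter> Z10 = {}"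
  "orbit R25 \<inter> Z25 = {}" "orbit R31 \<inter> Z31 = {}" "orbit R33 \<inter> Z33 = {}"
proof -
  show "orbit R01 \<inter> Z01 = {}" "orbit R02 \<inter> Z02 = {}" "orbit R04 \<inter> Z04 = {}"
    unfolding R_eq_mk Z01_def Z02_def Z04_def by (auto dest!: inv_orbit_RA)
  show "orbit R10 \<inter> Z10 = {}" using orbit_R10_not_in_Z10 by blast
  show "orbit R25 \<inter> Z25 = {}" "orbit R31 \<inter> Z31 = {}" "orbit R33 \<inter> Z33 = {}"
    unfolding R_eq_mk Z25_def Z31_def Z33_def by (auto dest!: orbit_RC_range simp: all_idx inv_famC0)
qed

subsection \<open>Components and dimension\<close>

text \<open>Each closed set contains the six representatives other than its own; this is what tells
  the seven orbits apart.\<close>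

lemma reps_in_Z:
  "{R02, R04, R10, R25, R31, R33} \<subseteq> Z01" "{R01, R04, R10, R25, R31, R33} \<subseteq> Z02"
  "{R01, R02, R10, R25, R31, R33} \<subseteq> Z04" "{R01, R02, R04, R25, R31, R33} \<subseteq> Z10"
  "{R01, R02, R04, R10, R31, R33} \<subseteq> Z25" "{R01, R02, R04, R10, R25, R33} \<subseteq> Z31"
  "{R01, R02, R04, R10, R25, R31} \<subseteq> Z33"
  by (simp_all add: Z01_def Z02_def Z04_def Z10_def Z25_def Z31_def Z33_def disc_def trf_def ltr_def rtr_def
      com_def tr_def R_eq_mk RA_def RC_def mk_def all_idx)

definition reps :: "sc set" where
  "reps = {R01, R02, R04, R10, R25, R31, R33}"

lemma card_reps: "card reps = 7"
proof -
  have "mk a1 a2 b1 b2 c1 c2 d1 d2 p1 p2 q1 q2 s1 s2 = mk a1' a2' b1' b2' c1' c2' d1' d2' p1' p2' q1' q2' s1' s2'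
    \<longleftrightarrow> a1 = a1' \<and> a2 = a2' \<and> b1 = b1' \<and> b2 = b2' \<and> c1 = c1' \<and> c2 = c2' \<and> d1 = d1' \<and> d2 = d2' \<and>
      p1 = p1' \<and> p2 = p2' \<and> q1 = q1' \<and> q2 = q2' \<and> s1 = s1' \<and> s2 = s2'"
    for a1 a2 b1 b2 c1 c2 d1 d2 p1 p2 q1 q2 s1 s2 a1' a2' b1' b2' c1' c2' d1' d2' p1' p2' q1' q2' s1' s2'
    by (simp add: mk_def fun_eq_iff all_idx) blast
  then show ?thesis by (simp add: reps_def R_eq_mk RA_def RC_def)
qed

lemma reps_in_PermVar: "reps \<subseteq> PermVar"
  unfolding reps_def using R10_in_PermVar by (auto simp: R_eq_mk(1-6) RA_in_PermVar RC_in_PermVar)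

text \<open>On the slice \<open>v 4 = v 5 = 1\<close> only four parameters remain, which yields the dimension bound.\<close>

definition param_orbit :: "sc \<Rightarrow> ((nat \<Rightarrow> complex) \<Rightarrow> sc) \<Rightarrow> bool" where
  "param_orbit R \<Phi> \<longleftrightarrow> pmap 6 \<Phi> \<and> pmap 4 (\<lambda>v. \<Phi> (v(4 := 1, 5 := 1))) \<and>
     (\<forall>v. v 4 \<noteq> 0 \<longrightarrow> v 5 \<noteq> 0 \<longrightarrow> \<Phi> v \<in> range (\<lambda>v. \<Phi> (v(4 := 1, 5 := 1)))) \<and>
     orbit R \<subseteq> range \<Phi> \<and> range \<Phi> \<subseteq> zclosure (orbit R)"

lemma famA_param:
  assumes "orbit (RA \<epsilon> \<eta>) \<subseteq> range (famA \<epsilon> \<eta>)"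
  shows "param_orbit (RA \<epsilon> \<eta>) (famA \<epsilon> \<eta>)"
proof -
  have p6: "pmap 6 (famA \<epsilon> \<eta>)"
    unfolding famA_def famA0_def by (intro pmap_mk mpoly_intros) simp_all
  have p4: "pmap 4 (\<lambda>v. famA \<epsilon> \<eta> (v(4 := 1, 5 := 1)))"
    unfolding famA_def famA0_def by simp (intro pmap_mk mpoly_intros; simp)
  \<comment> \<open>Every structure constant of \<open>famA0\<close> is linear in each of \<alpha>,
    \<beta> and s or zero, so scalars taken out of \<alpha> and \<beta> can be moved into s.\<close>
  have sl: "famA \<epsilon> \<eta> v \<in> range (\<lambda>v. famA \<epsilon> \<eta> (v(4 := 1, 5 := 1)))" if "v 4 \<noteq> 0" "v 5 \<noteq> 0" for v
    by (rule range_eqI[of _ _ "v(0 := v 0/v 4, 1 := v 1/v 5, 2 := v 2*v 4*v 5, 3 := v 3*v 4*v 5)"],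
        unfold famA_def famA0_def, rule mk_eqI) (use that in \<open>simp_all add: field_simps\<close>)
  have "range (famA \<epsilon> \<eta>) \<subseteq> zclosure (orbit (RA \<epsilon> \<eta>))"
  proof (rule range_subset_zclosure[OF p6])
    show "(\<lambda>v. (v 4*v 1 - v 0*v 5) * (v 4*v 3 - v 0*v 2) * (v 5*v 3 - v 1*v 2)) \<in> mpoly 6"
      by (intro mpoly_intros) simp_all
    \<comment> \<open>At this point \<alpha> = (1, 0), \<beta> = (0, 1) and s = (1, 1) are pairwise
      independent.\<close>
    let ?w = "(\<lambda>_. 1)(0 := 0, 5 := 0) :: nat \<Rightarrow> complex"
    show "(?w 4*?w 1 - ?w 0*?w 5) * (?w 4*?w 3 - ?w 0*?w 2) * (?w 5*?w 3 - ?w 1*?w 2) \<noteq> 0" by simp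
  qed (auto simp: famA_def intro!: famA0_in_orbit)
  then show ?thesis unfolding param_orbit_def using p6 p4 sl assms by blast
qed

lemma famB_param:
  assumes "orbit R10 \<subseteq> range famB" shows "param_orbit R10 famB"
proof -
  have p6: "pmap 6 famB"
    unfolding famB_def famB0_def by (intro pmap_mk mpoly_intros) simp_all
  have p4: "pmap 4 (\<lambda>v. famB (v(4 := 1, 5 := 1)))"
    unfolding famB_def famB0_def by simp (intro pmap_mk mpoly_intros; simp)
  \<comment> \<open>The constants are quadratic in \<chi> and linear in u, or bilinear in \<chi> and
    \<tau>: scaling \<chi> to first entry 1 costs u a square and \<tau> one factor.\<close>
  have sl: "famB v \<in> range (\<lambda>v. famB (v(4 := 1, 5 := 1)))" if "v 4 \<noteq> 0" for v
    by (rule range_eqI[of _ _ "v(0 := v 0/v 4, 1 := v 1*v 4*v 4, 2 := v 2*v 4*v 4, 3 := v 3*v 4)"],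
        unfold famB_def famB0_def, rule mk_eqI) (use that in \<open>simp_all add: field_simps\<close>)
  have "range famB \<subseteq> zclosure (orbit R10)"
  proof (rule range_subset_zclosure[OF p6])
    show "(\<lambda>v. (v 4*v 1 + v 0*v 2) * v 3) \<in> mpoly 6" by (intro mpoly_intros) simp_all
    let ?w = "(\<lambda>_. 1) :: nat \<Rightarrow> complex"
    show "(?w 4*?w 1 + ?w 0*?w 2) * ?w 3 \<noteq> 0" by simp
  qed (auto simp: famB_def intro!: famB0_in_orbit)
  then show ?thesis unfolding param_orbit_def using p6 p4 sl assms by blast
qed

lemma famC_param:
  assumes "orbit (RC \<epsilon> \<eta>) \<subseteq> range (famC \<epsilon> \<eta>)"
  shows "param_orbit (RC \<epsilon> \<eta>) (famC \<epsilon> \<eta>)"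
proof -
  have p6: "pmap 6 (famC \<epsilon> \<eta>)"
    unfolding famC_def famC0_def by (intro pmap_mk mpoly_intros) simp_all
  have p4: "pmap 4 (\<lambda>v. famC \<epsilon> \<eta> (v(4 := 1, 5 := 1)))"
    unfolding famC_def famC0_def by simp (intro pmap_mk mpoly_intros; simp)
  have sl: "famC \<epsilon> \<eta> v \<in> range (\<lambda>v. famC \<epsilon> \<eta> (v(4 := 1, 5 := 1)))" for v
    by (rule range_eqI[of _ _ v]) (simp add: famC_def)
  have "range (famC \<epsilon> \<eta>) \<subseteq> zclosure (orbit (RC \<epsilon> \<eta>))"
  proof (rule range_subset_zclosure[OF p6])
    show "(\<lambda>v. v 0) \<in> mpoly 6" by (intro mpoly_intros) simp_all
    show "(1::complex) \<noteq> 0" by simp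
  qed (auto simp: famC_def intro!: famC0_in_orbit)
  then show ?thesis unfolding param_orbit_def using p6 p4 sl assms by blast
qed

lemma orbit_eq_minusI:
  assumes "R \<in> PermVar" "orbit R \<inter> Z = {}" "PermVar - Z \<subseteq> orbit R \<inter> S"
  shows "orbit R = PermVar - Z" "orbit R \<subseteq> S"
  using assms orbit_subset_PermVar[OF assms(1)] by blast+

lemma reps_mem: "R01 \<in> PermVar" "R02 \<in> PermVar" "R04 \<in> PermVar" "R10 \<in> PermVar" "R25 \<in> PermVar" "R31 \<in> PermVar" "R33 \<in> PermVar"
  using reps_in_PermVar by (simp_all add: reps_def)

lemmas orbit_eq_minus_Z =
  orbit_eq_minusI(1)[OF reps_mem(1) orbit_disjoint_Z(1) PermVar_minus_Z(1)]
  orbit_eq_minusI(1)[OF reps_mem(2) orbit_disjoint_Z(2) PermVar_minus_Z(2)]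
  orbit_eq_minusI(1)[OF reps_mem(3) orbit_disjoint_Z(3) PermVar_minus_Z(3)]
  orbit_eq_minusI(1)[OF reps_mem(4) orbit_disjoint_Z(4) PermVar_minus_Z(4)]
  orbit_eq_minusI(1)[OF reps_mem(5) orbit_disjoint_Z(5) PermVar_minus_Z(5)]
  orbit_eq_minusI(1)[OF reps_mem(6) orbit_disjoint_Z(6) PermVar_minus_Z(6)]
  orbit_eq_minusI(1)[OF reps_mem(7) orbit_disjoint_Z(7) PermVar_minus_Z(7)]

lemmas orbit_subset_range =
  orbit_eq_minusI(2)[OF reps_mem(1) orbit_disjoint_Z(1) PermVar_minus_Z(1)]
  orbit_eq_minusI(2)[OF reps_mem(2) orbit_disjoint_Z(2) PermVar_minus_Z(2)]
  orbit_eq_minusI(2)[OF reps_mem(3) orbit_disjoint_Z(3) PermVar_minus_Z(3)]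
  orbit_eq_minusI(2)[OF reps_mem(4) orbit_disjoint_Z(4) PermVar_minus_Z(4)]
  orbit_eq_minusI(2)[OF reps_mem(5) orbit_disjoint_Z(5) PermVar_minus_Z(5)]
  orbit_eq_minusI(2)[OF reps_mem(6) orbit_disjoint_Z(6) PermVar_minus_Z(6)]
  orbit_eq_minusI(2)[OF reps_mem(7) orbit_disjoint_Z(7) PermVar_minus_Z(7)]

lemma param_reps:
  "param_orbit R01 (famA 0 0)" "param_orbit R02 (famA 1 1)" "param_orbit R04 (famA 0 1)" "param_orbit R10 famB"
  "param_orbit R25 (famC 0 0)" "param_orbit R31 (famC 0 1)" "param_orbit R33 (famC 1 1)"
  using famA_param orbit_subset_range(1-3) famB_param orbit_subset_range(4) famC_param orbit_subset_range(5-7)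
  by (simp_all only: R_eq_mk(1-6))

lemma reps_open:
  assumes "R \<in> reps"
  obtains Z where "zclosed Z" "orbit R = PermVar - Z" "reps - {R} \<subseteq> Z"
proof -
  consider "R = R01" | "R = R02" | "R = R04" | "R = R10" | "R = R25" | "R = R31" | "R = R33" using assms by (auto simp: reps_def)
  then show ?thesis
  proof cases
    case 1
    show ?thesis
      by (rule that[OF zclosed_Z(1) orbit_eq_minus_Z(1)[folded 1]]) (use reps_in_Z(1) in \<open>auto simp: reps_def 1\<close>)
  next
    case 2
    show ?thesis
      by (rule that[OF zclosed_Z(2) orbit_eq_minus_Z(2)[folded 2]]) (use reps_in_Z(2) in \<open>auto simp: reps_def 2\<close>)
  next
    case 3
    show ?thesis
      by (rule that[OF zclosed_Z(3) orbit_eq_minus_Z(3)[folded 3]]) (use reps_in_Z(3) in \<open>auto simp: reps_def 3\<close>)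
  next
    case 4
    show ?thesis
      by (rule that[OF zclosed_Z(4) orbit_eq_minus_Z(4)[folded 4]]) (use reps_in_Z(4) in \<open>auto simp: reps_def 4\<close>)
  next
    case 5
    show ?thesis
      by (rule that[OF zclosed_Z(5) orbit_eq_minus_Z(5)[folded 5]]) (use reps_in_Z(5) in \<open>auto simp: reps_def 5\<close>)
  next
    case 6
    show ?thesis
      by (rule that[OF zclosed_Z(6) orbit_eq_minus_Z(6)[folded 6]]) (use reps_in_Z(6) in \<open>auto simp: reps_def 6\<close>)
  next
    case 7
    show ?thesis
      by (rule that[OF zclosed_Z(7) orbit_eq_minus_Z(7)[folded 7]]) (use reps_in_Z(7) in \<open>auto simp: reps_def 7\<close>)
  qed
qed

lemma reps_param: "R \<in> reps \<Longrightarrow> \<exists>\<Phi>. param_orbit R \<Phi>"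
  unfolding reps_def using param_reps by blast

lemma param_zclosure_irreducible:
  assumes "param_orbit R \<Phi>" shows "zirreducible (zclosure (orbit R))"
proof -
  have "zclosure (orbit R) = zclosure (range \<Phi>)"
    using assms unfolding param_orbit_def by (intro zclosure_eqI) (meson subset_trans subset_zclosure)+
  then show ?thesis
    using assms zirreducible_zclosure[OF zirreducible_range[of 6 \<Phi>]] by (simp add: param_orbit_def)
qed

lemma param_chain_bound:
  assumes "param_orbit R \<Phi>" shows "\<not> irr_chain (zclosure (orbit R)) 5"
proof -
  let ?\<Psi> = "\<lambda>v. \<Phi> (v(4 := 1, 5 := 1))"
  have "range \<Phi> \<subseteq> zclosure (range ?\<Psi>)"
  proof (rule range_subset_zclosure[of 6])
    show "(\<lambda>v. v 4 * v 5) \<in> mpoly 6" by (intro mpoly_intros) simp_all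
    show "(1::complex) * 1 \<noteq> 0" by simp
  qed (use assms in \<open>auto simp: param_orbit_def\<close>)
  then have "zclosure (orbit R) \<subseteq> zclosure (range ?\<Psi>)"
    using assms zclosure_idem_subset unfolding param_orbit_def by (meson subset_trans)
  then have "\<not> irr_chain (zclosure (orbit R)) (Suc 4)"
    using assms by (intro irr_chain_bound) (auto simp: param_orbit_def)
  then show ?thesis by simp
qed

text \<open>A flag of linear subspaces of \<open>famB\<close> (with \<open>\<chi> = (1, 0)\<close>) inside the closure of the orbit of R10.\<close>

definition flag :: "nat \<Rightarrow> (nat \<Rightarrow> complex) \<Rightarrow> sc" where
  "flag n v = famB0 1 0 (if 0 < n then v 0 else 0) (if 1 < n then v 1 else 0) (if 2 < n then v 2 else 0)"

lemma flag_coords: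
  "flag n v E1 E1 E1 = (if 0 < n then v 0 else 0)" "flag n v E1 E1 E2 = (if 1 < n then v 1 else 0)"
  "flag n v F1 F1 E2 = (if 2 < n then v 2 else 0)" "flag n v E2 E2 E2 = 0"
  by (simp_all add: flag_def famB0_def mk_def)

text \<open>The range of an idempotent polynomial map is its fixed-point set, which is closed. Here
  the map reads off three coordinates by \<open>r\<close> and rebuilds the structure from
  them.\<close>

lemma zclosed_flag: "zclosed (range (flag n))"
proof -
  define r :: "sc \<Rightarrow> nat \<Rightarrow> complex" where
    "r c = (\<lambda>i. if i = 0 then c E1 E1 E1 else if i = 1 then c E1 E1 E2 else c F1 F1 E2)" for c
  have idem: "flag n (r (flag n v)) = flag n v" for v
  proof -
    have r: "r (flag n v) 0 = (if 0 < n then v 0 else 0)" "r (flag n v) 1 = (if 1 < n then v 1 else 0)"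
      "r (flag n v) 2 = (if 2 < n then v 2 else 0)"
      by (simp_all add: r_def flag_coords)
    show ?thesis unfolding flag_def[of n "r (flag n v)"] r by (simp add: flag_def)
  qed
  have "range (flag n) = {c. c = flag n (r c)}"
  proof (intro equalityI subsetI)
    fix c assume "c \<in> range (flag n)"
    then obtain v where "c = flag n v" by blast
    then show "c \<in> {c. c = flag n (r c)}" using idem[of v] by simp
  next
    fix c assume "c \<in> {c. c = flag n (r c)}"
    then show "c \<in> range (flag n)" by (intro range_eqI[of _ _ "r c"]) simp
  qed
  also have "\<dots> = {c. \<forall>i j k. c i j k = flag n (r c) i j k}" by (simp add: fun_eq_iff)
  also have "zclosed \<dots>"
  proof (intro zclosed_Collect_all zclosed_Collect_eq zpoly.coord)
    fix i j k
    have "(\<lambda>c. r c l) \<in> zpoly" for l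
      by (cases "l = 0"; cases "l = 1") (auto simp: r_def intro: zpoly.coord)
    then have "(\<lambda>c. if b then r c l else 0) \<in> zpoly" for b l
      by (cases b) (auto intro: zpoly.const)
    then show "(\<lambda>c. flag n (r c) i j k) \<in> zpoly"
      by (cases i; cases j; cases k) (auto simp: flag_def famB0_def mk_def intro: zpoly.const)
  qed
  finally show ?thesis .
qed

lemma pmap_flag: "pmap 3 (flag n)"
  unfolding pmap_def flag_def famB0_def mk_def all_idx
  by (cases "0 < n"; cases "1 < n"; cases "2 < n") (auto intro: mpoly.intros)

lemma flag_subset: "range (flag n) \<subseteq> range (flag (Suc n))"
proof -
  have "flag n v = flag (Suc n) (\<lambda>i. if i < n then v i else 0)" for v
    by (simp add: flag_def)
  then show ?thesis by auto
qed

lemma flag_strict: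
  assumes "n < 3" shows "range (flag n) \<subset> range (flag (Suc n))"
proof -
  have "flag (Suc n) (\<lambda>_. 1) \<noteq> flag n v" for v
  proof
    assume eq: "flag (Suc n) (\<lambda>_. 1) = flag n v"
    have "n = 0 \<or> n = 1 \<or> n = 2" using assms by auto
    then show False
      using arg_cong[OF eq, of "\<lambda>c. c E1 E1 E1"] arg_cong[OF eq, of "\<lambda>c. c E1 E1 E2"]
        arg_cong[OF eq, of "\<lambda>c. c F1 F1 E2"] by (auto simp: flag_coords)
  qed
  then show ?thesis using flag_subset[of n] by blast
qed

text \<open>Linear subspaces of dimensions 0 to 3 followed by the closure itself make four strict
  steps.\<close>

lemma irr_chain_R10: "irr_chain (zclosure (orbit R10)) 4"
proof -
  let ?Y = "zclosure (orbit R10)"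
  define f where "f i = (if i < 4 then range (flag i) else ?Y)" for i :: nat
  have rB: "range famB \<subseteq> ?Y" using param_reps(4) by (simp add: param_orbit_def)
  have sub: "range (flag i) \<subseteq> ?Y" for i
    using famB0_range rB unfolding flag_def by blast
  \<comment> \<open>A structure with e2 e2 = e2 lies outside the flag, all of whose members have e2
    e2 = 0.\<close>
  have "famB0 0 1 0 1 0 \<in> ?Y" using famB0_range rB by blast
  moreover have "famB0 0 1 0 1 0 \<noteq> flag 3 v" for v
  proof
    assume eq: "famB0 0 1 0 1 0 = flag 3 v"
    show False using flag_coords(4)[of 3 v, folded eq] by (simp add: famB0_def mk_def)
  qed
  ultimately have last: "range (flag 3) \<subset> ?Y" using sub[of 3] by blast
  have "f i \<subset> f (Suc i)" if "i < 4" for i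
    using that flag_strict[of i] last by (cases "i = 3") (auto simp: f_def)
  moreover have "zclosed (f i) \<and> zirreducible (f i) \<and> f i \<subseteq> ?Y" for i
    using zclosed_flag zirreducible_range[OF pmap_flag] sub zclosed_zclosure
      param_zclosure_irreducible[OF param_reps(4)] by (simp add: f_def)
  ultimately show ?thesis unfolding irr_chain_def by blast
qed

section \<open>Irreducible components, rigid structures and the dimension\<close>

lemma PermVar_Union: "PermVar = (\<Union>R\<in>reps. zclosure (orbit R))"
proof
  show "(\<Union>R\<in>reps. zclosure (orbit R)) \<subseteq> PermVar"
    using reps_in_PermVar orbit_subset_PermVar zclosure_minimal[OF zclosed_PermVar] by blast
  have sub: "range (famA 0 0) \<union> range (famA 0 1) \<union> range (famA 1 1) \<union> range famB \<union>
    range (famC 0 0) \<union> range (famC 0 1) \<union> range (famC 1 1) \<subseteq> (\<Union>R\<in>reps. zclosure (orbit R))"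
    using param_reps unfolding param_orbit_def reps_def by auto
  show "PermVar \<subseteq> (\<Union>R\<in>reps. zclosure (orbit R))"
    by (rule subsetI) (rule subsetD[OF sub PermVar_cases])
qed

text \<open>If the orbit of \<open>R'\<close> missed the open orbit of \<open>R\<close>, it would
  lie in the closed complement \<open>Z\<close>, and so would its closure, which contains
  \<open>c\<close>.\<close>

lemma open_meets_closure:
  assumes "zclosed Z" "orbit R = PermVar - Z" "c \<in> orbit R" "c \<in> zclosure (orbit R')" "orbit R' \<subseteq> PermVar"
  shows "orbit R = orbit R'"
proof -
  have "\<not> orbit R' \<subseteq> Z" using zclosure_minimal[OF assms(1)] assms(2-4) by blast
  then obtain y where "y \<in> orbit R'" "y \<in> orbit R" using assms(2,5) by blast
  then show ?thesis by (rule orbit_eq[rotated])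
qed

lemma reps_closure_eq:
  assumes R: "R \<in> reps" "R' \<in> reps" and c: "R \<in> zclosure (orbit R')"
  shows "R = R'"
proof (rule ccontr)
  assume ne: "R \<noteq> R'"
  obtain Z where Z: "zclosed Z" "orbit R = PermVar - Z" "reps - {R} \<subseteq> Z" using reps_open[OF R(1)] .
  have "orbit R = orbit R'"
    using open_meets_closure[OF Z(1,2) orbit_refl c] R(2) reps_in_PermVar orbit_subset_PermVar by blast
  then have "R' \<in> orbit R" using orbit_refl by simp
  then show False using Z ne R(2) by blast
qed

text \<open>An irreducible subset of the finite union lies in a single closure; since no closure
  contains another representative, each of the seven is maximal.\<close>

lemma irr_comp_PermVar: "{Y. irr_comp PermVar Y} = (\<lambda>R. zclosure (orbit R)) ` reps"
proof -
  have cover: "\<exists>R\<in>reps. Z \<subseteq> zclosure (orbit R)" if "zirreducible Z" "Z \<subseteq> PermVar" for Z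
  proof -
    have "finite ((\<lambda>R. zclosure (orbit R)) ` reps)" by (simp add: reps_def)
    moreover have "Z \<subseteq> (\<Union>R\<in>reps. zclosure (orbit R))" using that(2) by (simp only: PermVar_Union)
    ultimately have "\<exists>C\<in>(\<lambda>R. zclosure (orbit R)) ` reps. Z \<subseteq> C"
      by (rule zirreducible_subset_Union[OF _ that(1)]) (auto intro: zclosed_zclosure)
    then show ?thesis by simp
  qed
  have irr: "zirreducible (zclosure (orbit R))" if "R \<in> reps" for R
    using reps_param[OF that] param_zclosure_irreducible by blast
  have sub: "zclosure (orbit R) \<subseteq> PermVar" if "R \<in> reps" for R using that PermVar_Union by blast
  have comp: "irr_comp PermVar (zclosure (orbit R))" if R: "R \<in> reps" for R
    unfolding irr_comp_def
  proof (intro conjI allI impI)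
    fix Z assume Z: "Z \<subseteq> PermVar \<and> zirreducible Z \<and> zclosure (orbit R) \<subseteq> Z"
    then obtain R' where R': "R' \<in> reps" "Z \<subseteq> zclosure (orbit R')" using cover by blast
    have "R \<in> zclosure (orbit R)" using subset_zclosure orbit_refl by blast
    then have "R = R'" using reps_closure_eq[OF R R'(1)] Z R'(2) by blast
    then show "Z = zclosure (orbit R)" using Z R' by blast
  qed (use R sub irr zclosed_zclosure in auto)
  show ?thesis
  proof (intro equalityI subsetI)
    fix Y assume "Y \<in> {Y. irr_comp PermVar Y}"
    then have Y: "Y \<subseteq> PermVar" "zirreducible Y" "\<And>Z. Z \<subseteq> PermVar \<Longrightarrow> zirreducible Z \<Longrightarrow> Y \<subseteq> Z \<Longrightarrow> Z = Y"
      unfolding irr_comp_def by auto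
    obtain R where R: "R \<in> reps" "Y \<subseteq> zclosure (orbit R)" using cover[OF Y(2,1)] by blast
    have "zclosure (orbit R) = Y" by (rule Y(3)[OF sub[OF R(1)] irr[OF R(1)] R(2)])
    then show "Y \<in> (\<lambda>R. zclosure (orbit R)) ` reps" using R(1) by blast
  qed (use comp in auto)
qed

text \<open>A rigid structure lies in one of the seven closures, and its orbit, being open, must
  coincide with the orbit that is dense there.\<close>

lemma rigid_PermVar: "{orbit c | c. rigid PermVar c} = orbit ` reps"
proof (intro equalityI subsetI)
  fix O' assume "O' \<in> {orbit c | c. rigid PermVar c}"
  then obtain c Z where c: "O' = orbit c" "c \<in> PermVar" "zclosed Z" "orbit c = PermVar - Z"
    unfolding rigid_def by auto
  then obtain R where R: "R \<in> reps" "c \<in> zclosure (orbit R)" using PermVar_Union by blast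
  have "orbit c = orbit R"
    using open_meets_closure[OF c(3,4) orbit_refl R(2)] R(1) reps_in_PermVar orbit_subset_PermVar by blast
  then show "O' \<in> orbit ` reps" using c(1) R(1) by blast
next
  fix O' assume "O' \<in> orbit ` reps"
  then obtain R where R: "R \<in> reps" "O' = orbit R" by blast
  obtain Z where "zclosed Z" "orbit R = PermVar - Z" using reps_open[OF R(1)] .
  then have "rigid PermVar R" unfolding rigid_def using R(1) reps_in_PermVar by blast
  then show "O' \<in> {orbit c | c. rigid PermVar c}" using R(2) by blast
qed

lemma var_dim_PermVar: "var_dim PermVar 4"
proof -
  have bound: "\<not> irr_chain Y 5" if "irr_comp PermVar Y" for Y
  proof -
    have "Y \<in> (\<lambda>R. zclosure (orbit R)) ` reps" using that by (simp flip: irr_comp_PermVar)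
    then obtain R where R: "Y = zclosure (orbit R)" "R \<in> reps" by (rule imageE)
    obtain \<Phi> where "param_orbit R \<Phi>" using reps_param[OF R(2)] ..
    then show ?thesis unfolding R(1) by (rule param_chain_bound)
  qed
  have ex: "\<exists>e. zdim Y e" if "irr_comp PermVar Y" for Y
  proof -
    have 0: "irr_chain Y 0"
      using that unfolding irr_chain_def irr_comp_def by (intro exI[of _ "\<lambda>_. Y"]) simp
    have le: "n \<le> 4" if "irr_chain Y n" for n
    proof (rule ccontr)
      assume "\<not> n \<le> 4"
      then have "irr_chain Y 5" by (intro irr_chain_le[OF that]) simp
      then show False using bound[OF \<open>irr_comp PermVar Y\<close>] by simp
    qed
    \<comment> \<open>\<open>var_dim\<close> asks that every component have a dimension. The bound 4
      on chain lengths guarantees a greatest one, and the component alone is a chain of length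
      0.\<close>
    let ?e = "GREATEST n. irr_chain Y n"
    have "irr_chain Y ?e" by (rule GreatestI_nat[of "irr_chain Y", OF 0 le])
    moreover have "\<not> irr_chain Y (Suc ?e)"
      using Greatest_le_nat[of "irr_chain Y" "Suc ?e" 4] le by fastforce
    ultimately show ?thesis unfolding zdim_def by blast
  qed
  have "zclosure (orbit R10) \<in> {Y. irr_comp PermVar Y}"
    unfolding irr_comp_PermVar by (rule imageI) (simp add: reps_def)
  then have R10: "irr_comp PermVar (zclosure (orbit R10))" by simp
  have z4: "zdim (zclosure (orbit R10)) 4"
    unfolding zdim_def using irr_chain_R10 bound[OF R10] by simp
  have le: "e \<le> 4" if "irr_comp PermVar Y" "zdim Y e" for Y e
  proof (rule ccontr)
    assume "\<not> e \<le> 4"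
    then have "irr_chain Y 5" using that(2) unfolding zdim_def by (intro irr_chain_le[of Y e 5]) auto
    then show False using bound[OF that(1)] by simp
  qed
  show ?thesis unfolding var_dim_def
    by (intro conjI allI impI exI[of _ "zclosure (orbit R10)"]) (use ex R10 z4 le in auto)
qed

theorem mainTheorem8:
  shows "var_dim PermVar 4
    \<and> {Y. irr_comp PermVar Y} =
        {zclosure (orbit R01), zclosure (orbit R02), zclosure (orbit R04), zclosure (orbit R10),
         zclosure (orbit R25), zclosure (orbit R31), zclosure (orbit R33)}
    \<and> card {Y. irr_comp PermVar Y} = 7
    \<and> {orbit c | c. rigid PermVar c} =
        {orbit R01, orbit R02, orbit R04, orbit R10, orbit R25, orbit R31, orbit R33}
    \<and> card {orbit c | c. rigid PermVar c} = 7"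
proof -
  have mem: "R \<in> zclosure (orbit R)" for R using subset_zclosure orbit_refl by blast
  have "inj_on (\<lambda>R. zclosure (orbit R)) reps"
    by (rule inj_onI) (metis mem reps_closure_eq)
  moreover from this have "inj_on orbit reps" by (auto simp: inj_on_def)
  ultimately have "card {Y. irr_comp PermVar Y} = 7" "card {orbit c | c. rigid PermVar c} = 7"
    unfolding irr_comp_PermVar rigid_PermVar by (simp_all add: card_image card_reps)
  then show ?thesis
    using var_dim_PermVar unfolding irr_comp_PermVar rigid_PermVar by (simp add: reps_def)
qed

end
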